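(* Let $T$ be a complete first-order theory in a countable language $L$ and let $\mathfrak p(x)$ be a global type in one variable which is $\emptyset$-definable and strongly regular. Then $T$ has a quasiminimal model.
   Context: Work in a monster model $\mathfrak C$ of $T$ (a $\kappa$-saturated, strongly $\kappa$-homogeneous model for a very large $\kappa$; "small" means of cardinality $<\kappa$). A global type is a complete type over $\mathfrak C$; for $B \subseteq \mathfrak C$, $\mathfrak p|_B$ denotes the restriction of $\mathfrak p$ to formulas with parameters from $B$. $\mathfrak p$ is $\emptyset$-definable if for each $L$-formula $\phi(x,\bar y)$ there is an $L$-formula $d\phi(\bar y)$ without parameters such that for all $\bar a \in \mathfrak C$, $\phi(x,\bar a)\in\mathfrak p$ iff $\mathfrak C\models d\phi(\bar a)$. $\mathfrak p$ is $\emptyset$-invariant if it is fixed by all automorphisms of $\mathfrak C$. $\mathfrak p$ is strongly regular if it is $\emptyset$-invariant and for every small $B \subseteq \mathfrak C$ and every $a \in \mathfrak C$, either $a$ realises $\mathfrak p|_B$ or $\mathfrak p|_B \vdash \mathfrak p|_{B\cup\{a\}}$ (i.e. $\mathfrak p|_B$ has a unique extension to a complete type over $B \cup\{a\}$). A structure is quasiminimal if it is uncountable and every subset of it definable with parameters is either countable or co-countable.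
   Formalization: The global type p is additionally assumed non-algebraic (no formula in p has only finitely many solutions); otherwise the type of a named constant is definable and strongly regular, and the claim fails, for example for the theory of a finite structure. *)

theory Defs
  imports "HOL-Library.Countable_Set"
begin

unbundle cardinal_syntax

section \<open>First-order languages, structures and satisfaction\<close>

text \<open>A language is a set of function symbols and a set of relation symbols with arities
  (constants are function symbols of arity 0). Variables are natural numbers. The syntax is untyped
  with respect to the language; membership in the language is the predicate \<open>lfm\<close> below.\<close>

record ('f, 'r) lang =
  fun_syms :: "'f set"
  rel_syms :: "'r set"
  fun_ar :: "'f \<Rightarrow> nat"
  rel_ar :: "'r \<Rightarrow> nat"

definition countable_lang :: "('f, 'r) lang \<Rightarrow> bool" where
  "countable_lang L \<longleftrightarrow> countable (fun_syms L) \<and> countable (rel_syms L)"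

datatype 'f tm = Var nat | Fn 'f "'f tm list"

datatype ('f, 'r) fm =
    Eq "'f tm" "'f tm"
  | Rel 'r "'f tm list"
  | Neg "('f, 'r) fm"
  | Conj "('f, 'r) fm" "('f, 'r) fm"
  | Ex nat "('f, 'r) fm"

fun ltm :: "('f, 'r) lang \<Rightarrow> 'f tm \<Rightarrow> bool" where
  "ltm L (Var n) \<longleftrightarrow> True"
| "ltm L (Fn f ts) \<longleftrightarrow>
     f \<in> fun_syms L \<and> length ts = fun_ar L f \<and> (\<forall>t\<in>set ts. ltm L t)"

primrec lfm :: "('f, 'r) lang \<Rightarrow> ('f, 'r) fm \<Rightarrow> bool" where
  "lfm L (Eq s t) \<longleftrightarrow> ltm L s \<and> ltm L t"
| "lfm L (Rel r ts) \<longleftrightarrow> r \<in> rel_syms L \<and> length ts = rel_ar L r \<and> (\<forall>t\<in>set ts. ltm L t)"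
| "lfm L (Neg \<phi>) \<longleftrightarrow> lfm L \<phi>"
| "lfm L (Conj \<phi> \<psi>) \<longleftrightarrow> lfm L \<phi> \<and> lfm L \<psi>"
| "lfm L (Ex n \<phi>) \<longleftrightarrow> lfm L \<phi>"

fun fvt :: "'f tm \<Rightarrow> nat set" where
  "fvt (Var n) = {n}"
| "fvt (Fn f ts) = (\<Union>t\<in>set ts. fvt t)"

primrec fv :: "('f, 'r) fm \<Rightarrow> nat set" where
  "fv (Eq s t) = fvt s \<union> fvt t"
| "fv (Rel r ts) = (\<Union>t\<in>set ts. fvt t)"
| "fv (Neg \<phi>) = fv \<phi>"
| "fv (Conj \<phi> \<psi>) = fv \<phi> \<union> fv \<psi>"
| "fv (Ex n \<phi>) = fv \<phi> - {n}"

definition sentences :: "('f, 'r) lang \<Rightarrow> ('f, 'r) fm set" where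
  "sentences L = {\<phi>. lfm L \<phi> \<and> fv \<phi> = {}}"

text \<open>Only the values of the interpretations on tuples of the right length from \<open>dom M\<close> matter.\<close>

record ('f, 'r, 'a) struct =
  dom :: "'a set"
  fint :: "'f \<Rightarrow> 'a list \<Rightarrow> 'a"
  rint :: "'r \<Rightarrow> 'a list \<Rightarrow> bool"

definition is_struct :: "('f, 'r) lang \<Rightarrow> ('f, 'r, 'a) struct \<Rightarrow> bool" where
  "is_struct L M \<longleftrightarrow> dom M \<noteq> {} \<and>
     (\<forall>f\<in>fun_syms L. \<forall>xs\<in>lists (dom M). length xs = fun_ar L f \<longrightarrow> fint M f xs \<in> dom M)"

primrec evalt :: "('f, 'r, 'a) struct \<Rightarrow> (nat \<Rightarrow> 'a) \<Rightarrow> 'f tm \<Rightarrow> 'a" where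
  "evalt M e (Var n) = e n"
| "evalt M e (Fn f ts) = fint M f (map (evalt M e) ts)"

primrec sat :: "('f, 'r, 'a) struct \<Rightarrow> (nat \<Rightarrow> 'a) \<Rightarrow> ('f, 'r) fm \<Rightarrow> bool" where
  "sat M e (Eq s t) \<longleftrightarrow> evalt M e s = evalt M e t"
| "sat M e (Rel r ts) \<longleftrightarrow> rint M r (map (evalt M e) ts)"
| "sat M e (Neg \<phi>) \<longleftrightarrow> \<not> sat M e \<phi>"
| "sat M e (Conj \<phi> \<psi>) \<longleftrightarrow> sat M e \<phi> \<and> sat M e \<psi>"
| "sat M e (Ex n \<phi>) \<longleftrightarrow> (\<exists>a\<in>dom M. sat M (e(n := a)) \<phi>)"

definition is_model :: "('f, 'r) lang \<Rightarrow> ('f, 'r, 'a) struct \<Rightarrow> ('f, 'r) fm set \<Rightarrow> bool" where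
  "is_model L M T \<longleftrightarrow> is_struct L M \<and> (\<forall>\<phi>\<in>T. \<forall>e. sat M e \<phi>)"

text \<open>Consistency and consequence are tested on structures whose universe is a set of natural
  numbers. These are, up to isomorphism, all countable (including finite) structures, so for a
  countable language this is the same as testing on all structures, by the downward
  Loewenheim-Skolem theorem.\<close>

definition entails :: "('f, 'r) lang \<Rightarrow> ('f, 'r) fm set \<Rightarrow> ('f, 'r) fm \<Rightarrow> bool" where
  "entails L T \<phi> \<longleftrightarrow> (\<forall>M :: ('f, 'r, nat) struct. is_model L M T \<longrightarrow> (\<forall>e. sat M e \<phi>))"

definition complete_theory :: "('f, 'r) lang \<Rightarrow> ('f, 'r) fm set \<Rightarrow> bool" where
  "complete_theory L T \<longleftrightarrow> T \<subseteq> sentences L \<and>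
     (\<exists>M :: ('f, 'r, nat) struct. is_model L M T) \<and>
     (\<forall>\<phi>\<in>sentences L. entails L T \<phi> \<or> entails L T (Neg \<phi>))"


section \<open>Formulas with parameters, definable sets and types in one variable\<close>

text \<open>The type variable \<open>x\<close> is variable 0. A formula \<open>\<phi>(x, b)\<close> with a tuple \<open>b\<close> of parameters is
  represented by the pair of the \<open>L\<close>-formula \<open>\<phi>\<close> and an assignment \<open>e\<close> of parameters to its free
  variables other than 0; the values of \<open>e\<close> elsewhere are irrelevant.\<close>

type_synonym ('f, 'r, 'a) pfm = "('f, 'r) fm \<times> (nat \<Rightarrow> 'a)"

definition pforms :: "('f, 'r) lang \<Rightarrow> 'a set \<Rightarrow> ('f, 'r, 'a) pfm set" where
  "pforms L B = {(\<phi>, e). lfm L \<phi> \<and> e ` (fv \<phi> - {0}) \<subseteq> B}"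

definition solutions :: "('f, 'r, 'a) struct \<Rightarrow> ('f, 'r, 'a) pfm \<Rightarrow> 'a set" where
  "solutions M = (\<lambda>(\<phi>, e). {c \<in> dom M. sat M (e(0 := c)) \<phi>})"

definition realises :: "('f, 'r, 'a) struct \<Rightarrow> 'a \<Rightarrow> ('f, 'r, 'a) pfm set \<Rightarrow> bool" where
  "realises M c q \<longleftrightarrow> c \<in> dom M \<and> (\<forall>\<theta>\<in>q. c \<in> solutions M \<theta>)"

text \<open>Consistency of \<open>q\<close> with the elementary diagram of \<open>M\<close> is finite satisfiability in \<open>M\<close>.\<close>

definition complete_type ::
    "('f, 'r) lang \<Rightarrow> ('f, 'r, 'a) struct \<Rightarrow> 'a set \<Rightarrow> ('f, 'r, 'a) pfm set \<Rightarrow> bool" where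
  "complete_type L M B q \<longleftrightarrow> q \<subseteq> pforms L B \<and>
     (\<forall>q0 \<subseteq> q. finite q0 \<longrightarrow> (\<exists>c. realises M c q0)) \<and>
     (\<forall>(\<phi>, e)\<in>pforms L B. (\<phi>, e) \<in> q \<or> (Neg \<phi>, e) \<in> q)"

definition global_type ::
    "('f, 'r) lang \<Rightarrow> ('f, 'r, 'a) struct \<Rightarrow> ('f, 'r, 'a) pfm set \<Rightarrow> bool" where
  "global_type L M p \<longleftrightarrow> complete_type L M (dom M) p"

definition restrict_type ::
    "('f, 'r) lang \<Rightarrow> ('f, 'r, 'a) pfm set \<Rightarrow> 'a set \<Rightarrow> ('f, 'r, 'a) pfm set" where
  "restrict_type L p B = p \<inter> pforms L B"

definition quasiminimal :: "('f, 'r) lang \<Rightarrow> ('f, 'r, 'a) struct \<Rightarrow> bool" where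
  "quasiminimal L M \<longleftrightarrow> uncountable (dom M) \<and>
     (\<forall>\<theta>\<in>pforms L (dom M). countable (solutions M \<theta>) \<or> countable (dom M - solutions M \<theta>))"


section \<open>Monster models\<close>

definition automorphism ::
    "('f, 'r) lang \<Rightarrow> ('f, 'r, 'a) struct \<Rightarrow> ('a \<Rightarrow> 'a) \<Rightarrow> bool" where
  "automorphism L M \<sigma> \<longleftrightarrow> bij_betw \<sigma> (dom M) (dom M) \<and>
     (\<forall>f\<in>fun_syms L. \<forall>xs\<in>lists (dom M). length xs = fun_ar L f \<longrightarrow>
        \<sigma> (fint M f xs) = fint M f (map \<sigma> xs)) \<and>
     (\<forall>r\<in>rel_syms L. \<forall>xs\<in>lists (dom M). length xs = rel_ar L r \<longrightarrow>
        (rint M r (map \<sigma> xs) \<longleftrightarrow> rint M r xs))"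

definition partial_elementary ::
    "('f, 'r) lang \<Rightarrow> ('f, 'r, 'a) struct \<Rightarrow> 'a set \<Rightarrow> ('a \<Rightarrow> 'a) \<Rightarrow> bool" where
  "partial_elementary L M A g \<longleftrightarrow> A \<subseteq> dom M \<and> g ` A \<subseteq> dom M \<and>
     (\<forall>\<phi> e. lfm L \<phi> \<longrightarrow> e ` fv \<phi> \<subseteq> A \<longrightarrow> (sat M (g \<circ> e) \<phi> \<longleftrightarrow> sat M e \<phi>))"

definition saturated ::
    "('f, 'r) lang \<Rightarrow> 'k rel \<Rightarrow> ('f, 'r, 'a) struct \<Rightarrow> bool" where
  "saturated L \<kappa> M \<longleftrightarrow>
     (\<forall>A \<subseteq> dom M. |A| <o \<kappa> \<longrightarrow> (\<forall>q. complete_type L M A q \<longrightarrow> (\<exists>c. realises M c q)))"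

definition strongly_homogeneous ::
    "('f, 'r) lang \<Rightarrow> 'k rel \<Rightarrow> ('f, 'r, 'a) struct \<Rightarrow> bool" where
  "strongly_homogeneous L \<kappa> M \<longleftrightarrow>
     (\<forall>A g. |A| <o \<kappa> \<longrightarrow> partial_elementary L M A g \<longrightarrow>
        (\<exists>\<sigma>. automorphism L M \<sigma> \<and> (\<forall>a\<in>A. \<sigma> a = g a)))"

text \<open>``Very large'' is read as ``uncountable'', i.e. larger than the countable language. This is
  the weakest reading, hence it covers every larger choice of the cardinal.\<close>

definition monster_model ::
    "('f, 'r) lang \<Rightarrow> ('f, 'r) fm set \<Rightarrow> 'k rel \<Rightarrow> ('f, 'r, 'a) struct \<Rightarrow> bool" where
  "monster_model L T \<kappa> M \<longleftrightarrow> Card_order \<kappa> \<and> natLeq <o \<kappa> \<and> is_model L M T \<and>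
     saturated L \<kappa> M \<and> strongly_homogeneous L \<kappa> M"


section \<open>Definable, invariant and strongly regular global types\<close>

definition definable_over_empty ::
    "('f, 'r) lang \<Rightarrow> ('f, 'r, 'a) struct \<Rightarrow> ('f, 'r, 'a) pfm set \<Rightarrow> bool" where
  "definable_over_empty L M p \<longleftrightarrow>
     (\<forall>\<phi>. lfm L \<phi> \<longrightarrow> (\<exists>d\<phi>. lfm L d\<phi> \<and> fv d\<phi> \<subseteq> fv \<phi> - {0} \<and>
        (\<forall>e. (\<phi>, e) \<in> pforms L (dom M) \<longrightarrow> ((\<phi>, e) \<in> p \<longleftrightarrow> sat M e d\<phi>))))"

definition invariant_over_empty ::
    "('f, 'r) lang \<Rightarrow> ('f, 'r, 'a) struct \<Rightarrow> ('f, 'r, 'a) pfm set \<Rightarrow> bool" where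
  "invariant_over_empty L M p \<longleftrightarrow>
     (\<forall>\<sigma>. automorphism L M \<sigma> \<longrightarrow>
        (\<forall>(\<phi>, e)\<in>pforms L (dom M). (\<phi>, \<sigma> \<circ> e) \<in> p \<longleftrightarrow> (\<phi>, e) \<in> p))"

definition strongly_regular ::
    "('f, 'r) lang \<Rightarrow> 'k rel \<Rightarrow> ('f, 'r, 'a) struct \<Rightarrow> ('f, 'r, 'a) pfm set \<Rightarrow> bool" where
  "strongly_regular L \<kappa> M p \<longleftrightarrow> invariant_over_empty L M p \<and>
     (\<forall>B \<subseteq> dom M. |B| <o \<kappa> \<longrightarrow> (\<forall>a\<in>dom M.
        realises M a (restrict_type L p B) \<or>
        (\<exists>!q. complete_type L M (B \<union> {a}) q \<and> restrict_type L p B \<subseteq> q)))"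

text \<open>Regularity is only considered for non-algebraic global types. A realised global type, such as
  the type of a constant symbol, meets the conditions above trivially, and theories having such
  types need not have quasiminimal models (they may have only finite ones, for example).\<close>

definition nonalgebraic ::
    "('f, 'r, 'a) struct \<Rightarrow> ('f, 'r, 'a) pfm set \<Rightarrow> bool" where
  "nonalgebraic M p \<longleftrightarrow> (\<forall>\<theta>\<in>p. infinite (solutions M \<theta>))"

end

(* Call a definable set large if its formula belongs to p. Given a countable elementary M, look for
   a proper countable elementary extension N all of whose new elements realise p|M. Then a maximal
   chain of such extensions of countable models has an uncountable union, in which every definable
   set is, up to a countable model of the chain, empty or everything.

   N is obtained by adding a realisation a of p|M and omitting the types "y lies in the non-large
   M-definable set Y and is not in M". If a formula R(y, a) had a solution c in Y, but none in
   M, then c does not realise p|M, so strong regularity gives R(c, x) in p; by definability of p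
   this is a first-order condition on c over M, so it has a solution c' in Y that lies in M, and
   then R(c', x) in p|M gives R(c', a), a contradiction. *)

theory Submission
  imports Defs "HOL-Library.Countable_Set_Type"
begin

section \<open>Satisfaction and renaming of variables\<close>

lemma evalt_cong: "(\<And>v. v \<in> fvt t \<Longrightarrow> e v = e' v) \<Longrightarrow> evalt M e t = evalt M e' t"
proof (induction t)
  case (Fn f ts)
  have "map (evalt M e) ts = map (evalt M e') ts"
    unfolding map_eq_conv
  proof
    fix t assume t: "t \<in> set ts"
    show "evalt M e t = evalt M e' t"
      by (rule Fn.IH[OF t]) (use t Fn.prems in auto)
  qed
  then show ?case by (simp only: evalt.simps)
qed simp

lemma sat_cong: "(\<And>v. v \<in> fv \<phi> \<Longrightarrow> e v = e' v) \<Longrightarrow> sat M e \<phi> \<longleftrightarrow> sat M e' \<phi>"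
proof (induction \<phi> arbitrary: e e')
  case (Eq s t)
  have "evalt M e s = evalt M e' s" "evalt M e t = evalt M e' t"
    by (rule evalt_cong, use Eq in auto)+
  then show ?case by simp
next
  case (Rel r ts)
  have "map (evalt M e) ts = map (evalt M e') ts"
    unfolding map_eq_conv by (intro ballI evalt_cong) (use Rel in auto)
  then show ?case by (simp only: sat.simps)
next
  case (Neg \<phi>)
  have "sat M e \<phi> \<longleftrightarrow> sat M e' \<phi>"
    by (rule Neg.IH) (use Neg.prems in auto)
  then show ?case by simp
next
  case (Conj \<phi> \<psi>)
  have "sat M e \<phi> \<longleftrightarrow> sat M e' \<phi>"
    by (rule Conj.IH) (use Conj.prems in auto)
  moreover have "sat M e \<psi> \<longleftrightarrow> sat M e' \<psi>"
    by (rule Conj.IH) (use Conj.prems in auto)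
  ultimately show ?case by simp
next
  case (Ex n \<phi>)
  have "sat M (e(n := a)) \<phi> \<longleftrightarrow> sat M (e'(n := a)) \<phi>" for a
    by (rule Ex.IH) (use Ex.prems in auto)
  then show ?case by simp
qed

lemma finite_fvt: "finite (fvt t)"
  by (induction t) auto

lemma finite_fv: "finite (fv \<phi>)"
  by (induction \<phi>) (auto simp: finite_fvt)

primrec rename_tm :: "(nat \<Rightarrow> nat) \<Rightarrow> 'f tm \<Rightarrow> 'f tm" where
  "rename_tm \<rho> (Var n) = Var (\<rho> n)"
| "rename_tm \<rho> (Fn f ts) = Fn f (map (rename_tm \<rho>) ts)"

text \<open>Bound variables are renamed together with the free ones, so that an injective
  \<open>\<rho>\<close> never captures a variable.\<close>

primrec rename_fm :: "(nat \<Rightarrow> nat) \<Rightarrow> ('f, 'r) fm \<Rightarrow> ('f, 'r) fm" where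
  "rename_fm \<rho> (Eq s t) = Eq (rename_tm \<rho> s) (rename_tm \<rho> t)"
| "rename_fm \<rho> (Rel r ts) = Rel r (map (rename_tm \<rho>) ts)"
| "rename_fm \<rho> (Neg \<phi>) = Neg (rename_fm \<rho> \<phi>)"
| "rename_fm \<rho> (Conj \<phi> \<psi>) = Conj (rename_fm \<rho> \<phi>) (rename_fm \<rho> \<psi>)"
| "rename_fm \<rho> (Ex n \<phi>) = Ex (\<rho> n) (rename_fm \<rho> \<phi>)"

lemma ltm_rename [simp]: "ltm L (rename_tm \<rho> t) \<longleftrightarrow> ltm L t"
  by (induction t) auto

lemma lfm_rename [simp]: "lfm L (rename_fm \<rho> \<phi>) \<longleftrightarrow> lfm L \<phi>"
  by (induction \<phi>) auto

lemma fvt_rename [simp]: "fvt (rename_tm \<rho> t) = \<rho> ` fvt t"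
  by (induction t) auto

lemma fv_rename: "inj \<rho> \<Longrightarrow> fv (rename_fm \<rho> \<phi>) = \<rho> ` fv \<phi>"
  by (induction \<phi>) (auto simp: image_Un image_set_diff)

lemma evalt_rename: "evalt M e (rename_tm \<rho> t) = evalt M (e \<circ> \<rho>) t"
  by (induction t) (auto intro!: arg_cong[where f = "fint M _"])

lemma sat_rename: "inj \<rho> \<Longrightarrow> sat M e (rename_fm \<rho> \<phi>) \<longleftrightarrow> sat M (e \<circ> \<rho>) \<phi>"
proof (induction \<phi> arbitrary: e)
  case (Rel r ts)
  have "map (evalt M e) (map (rename_tm \<rho>) ts) = map (evalt M (e \<circ> \<rho>)) ts"
    by (simp add: evalt_rename)
  then show ?case by (simp only: rename_fm.simps sat.simps)
next
  case (Ex n \<phi>)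
  have "e(\<rho> n := a) \<circ> \<rho> = (e \<circ> \<rho>)(n := a)" for a
    using Ex.prems by (auto simp: fun_eq_iff inj_eq)
  then show ?case by (simp only: rename_fm.simps sat.simps Ex.IH[OF Ex.prems])
qed (simp_all add: evalt_rename)

text \<open>Takes the place of a substitution of one variable for several. Each variable
  \<open>i\<close> of \<open>S\<close> is bound by a quantifier that forces it to equal
  \<open>j\<close>; the witness is \<open>e j\<close>, hence the condition that \<open>e j\<close>
  lies in the universe.\<close>

lemma merge_variables:
  assumes "finite S" "j \<notin> S" "lfm L \<phi>"
  shows "\<exists>\<phi>'. lfm L \<phi>' \<and> fv \<phi>' \<subseteq> (fv \<phi> - S) \<union> {j} \<and>
    (\<forall>e. e j \<in> dom M \<longrightarrow> (sat M e \<phi>' \<longleftrightarrow> sat M (\<lambda>v. if v \<in> S then e j else e v) \<phi>))"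
  using assms
proof (induction S rule: finite_induct)
  case empty
  then show ?case by (intro exI[of _ \<phi>]) auto
next
  case (insert i S)
  then obtain \<phi>' where \<phi>': "lfm L \<phi>'" "fv \<phi>' \<subseteq> (fv \<phi> - S) \<union> {j}"
    "\<And>e. e j \<in> dom M \<Longrightarrow> sat M e \<phi>' \<longleftrightarrow> sat M (\<lambda>v. if v \<in> S then e j else e v) \<phi>"
    by auto
  have ij: "i \<noteq> j" using insert by auto
  show ?case
  proof (intro exI[of _ "Ex i (Conj (Eq (Var i) (Var j)) \<phi>')"] conjI allI impI)
    fix e assume ej: "e j \<in> dom M"
    have eq: "(\<lambda>v. if v \<in> S then e j else (e(i := e j)) v) =
        (\<lambda>v. if v \<in> insert i S then e j else e v)"
      by auto
    have "sat M e (Ex i (Conj (Eq (Var i) (Var j)) \<phi>')) \<longleftrightarrow> sat M (e(i := e j)) \<phi>'"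
      using ij ej by auto
    also have "\<dots> \<longleftrightarrow> sat M (\<lambda>v. if v \<in> insert i S then e j else e v) \<phi>"
      using \<phi>'(3)[of "e(i := e j)"] fun_upd_other[OF ij[symmetric], of e "e j"] ej
      unfolding eq[symmetric] by (simp only:)
    finally show "sat M e (Ex i (Conj (Eq (Var i) (Var j)) \<phi>')) \<longleftrightarrow>
        sat M (\<lambda>v. if v \<in> insert i S then e j else e v) \<phi>" .
  qed (use \<phi>' ij in auto)
qed

section \<open>Countability of the set of formulas\<close>

instance tm :: (countable) countable
  by countable_datatype

instance fm :: (countable, countable) countable
  by countable_datatype

lemma ltm_symbols: "ltm L t \<Longrightarrow> set_tm t \<subseteq> fun_syms L"
  by (induction t) auto

lemma lfm_symbols: "lfm L \<phi> \<Longrightarrow> set1_fm \<phi> \<subseteq> fun_syms L \<and> set2_fm \<phi> \<subseteq> rel_syms L"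
  by (induction \<phi>) (auto dest: ltm_symbols)

text \<open>\<open>countable_lang\<close> bounds the symbols of the language, not the types they are
  drawn from. Coding the symbols by natural numbers is injective on the formulas of the language and
  lands in a countable type.\<close>

lemma countable_lfm:
  assumes "countable_lang L"
  shows "countable {\<phi>. lfm L \<phi>}"
proof -
  define f where "f = to_nat_on (fun_syms L)"
  define r where "r = to_nat_on (rel_syms L)"
  have f: "inj_on f (fun_syms L)" and r: "inj_on r (rel_syms L)"
    using assms unfolding f_def r_def countable_lang_def by (auto intro: inj_on_to_nat_on)
  have "inj_on (map_fm f r) {\<phi>. lfm L \<phi>}"
  proof (rule inj_onI)
    fix \<phi> \<psi> assume *: "\<phi> \<in> {\<phi>. lfm L \<phi>}" "\<psi> \<in> {\<phi>. lfm L \<phi>}" "map_fm f r \<phi> = map_fm f r \<psi>"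
    show "\<phi> = \<psi>"
    proof (rule fm.inj_map_strong[OF _ _ *(3)])
      show "z = za" if "z \<in> set1_fm \<phi>" "za \<in> set1_fm \<psi>" "f z = f za" for z za
        using that * lfm_symbols[of L] inj_onD[OF f] by blast
      show "z = za" if "z \<in> set2_fm \<phi>" "za \<in> set2_fm \<psi>" "r z = r za" for z za
        using that * lfm_symbols[of L] inj_onD[OF r] by blast
    qed
  qed
  then show ?thesis
    using countableI_type countable_image_inj_on by blast
qed

section \<open>Definable sets and binary relations\<close>

locale ambient_structure =
  fixes L :: "('f, 'r) lang" and \<CC> :: "('f, 'r, 'a) struct"
  assumes is_struct: "is_struct L \<CC>"
begin

definition definable_sets :: "'a set \<Rightarrow> 'a set set" where
  "definable_sets B = solutions \<CC> ` pforms L B"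

definition rel_of :: "('f, 'r) fm \<Rightarrow> (nat \<Rightarrow> 'a) \<Rightarrow> 'a rel" where
  "rel_of \<phi> e = {(x, y). x \<in> dom \<CC> \<and> y \<in> dom \<CC> \<and> sat \<CC> (e(0 := x, 1 := y)) \<phi>}"

text \<open>With binary relations, a formula over \<open>B\<close> and one more parameter becomes a
  section of a relation over \<open>B\<close>. Most later arguments then use closure properties
  instead of formulas.\<close>

definition definable_rels :: "'a set \<Rightarrow> 'a rel set" where
  "definable_rels B = {rel_of \<phi> e | \<phi> e. lfm L \<phi> \<and> e ` (fv \<phi> - {0, 1}) \<subseteq> B}"

lemma definable_set_subset: "X \<in> definable_sets B \<Longrightarrow> X \<subseteq> dom \<CC>"
  by (auto simp: definable_sets_def solutions_def)

lemma definable_rel_subset: "R \<in> definable_rels B \<Longrightarrow> R \<subseteq> dom \<CC> \<times> dom \<CC>"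
  by (auto simp: definable_rels_def rel_of_def)

lemma definable_sets_mono: "B \<subseteq> B' \<Longrightarrow> definable_sets B \<subseteq> definable_sets B'"
  unfolding definable_sets_def pforms_def by (intro image_mono) auto

lemma definable_rels_mono: "B \<subseteq> B' \<Longrightarrow> definable_rels B \<subseteq> definable_rels B'"
  unfolding definable_rels_def by (intro Collect_mono) (metis subset_trans)

lemma definable_setI:
  assumes "lfm L \<phi>" "e ` (fv \<phi> - {n}) \<subseteq> B"
  shows "{x \<in> dom \<CC>. sat \<CC> (e(n := x)) \<phi>} \<in> definable_sets B"
proof -
  \<comment> \<open>Variable \<open>n\<close> moves to 0, the place of the type variable, and all
    others are shifted out of its way; \<open>?e\<close> undoes the shift.\<close>
  define \<rho> where "\<rho> = (\<lambda>v. if v = n then 0 else Suc v)"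
  have \<rho>: "inj \<rho>" by (auto simp: inj_def \<rho>_def)
  let ?\<phi> = "rename_fm \<rho> \<phi>" and ?e = "\<lambda>v. e (v - 1)"
  have "?e ` (fv ?\<phi> - {0}) \<subseteq> B"
    using assms unfolding fv_rename[OF \<rho>] by (auto simp: \<rho>_def)
  then have "(?\<phi>, ?e) \<in> pforms L B"
    using assms(1) by (simp add: pforms_def)
  moreover have "sat \<CC> (?e(0 := x)) ?\<phi> \<longleftrightarrow> sat \<CC> (e(n := x)) \<phi>" for x
    unfolding sat_rename[OF \<rho>] by (rule sat_cong) (auto simp: \<rho>_def)
  then have "solutions \<CC> (?\<phi>, ?e) = {x \<in> dom \<CC>. sat \<CC> (e(n := x)) \<phi>}"
    by (simp add: solutions_def)
  ultimately show ?thesis unfolding definable_sets_def by (metis imageI)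
qed

lemma definable_relI:
  assumes "lfm L \<phi>" "e ` (fv \<phi> - {m, n}) \<subseteq> B" "m \<noteq> n"
  shows "{(x, y). x \<in> dom \<CC> \<and> y \<in> dom \<CC> \<and> sat \<CC> (e(m := x, n := y)) \<phi>} \<in> definable_rels B"
proof -
  define \<rho> where "\<rho> = (\<lambda>v. if v = m then 0 else if v = n then 1 else v + 2)"
  have \<rho>: "inj \<rho>" by (auto simp: inj_def \<rho>_def)
  let ?\<phi> = "rename_fm \<rho> \<phi>" and ?e = "\<lambda>v. e (v - 2)"
  have "?e ` (fv ?\<phi> - {0, 1}) \<subseteq> B"
    using assms unfolding fv_rename[OF \<rho>] by (auto simp: \<rho>_def split: if_splits)
  moreover have "sat \<CC> (?e(0 := x, 1 := y)) ?\<phi> \<longleftrightarrow> sat \<CC> (e(m := x, n := y)) \<phi>" for x y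
    unfolding sat_rename[OF \<rho>] by (rule sat_cong) (use assms in \<open>auto simp: \<rho>_def\<close>)
  then have "rel_of ?\<phi> ?e =
      {(x, y). x \<in> dom \<CC> \<and> y \<in> dom \<CC> \<and> sat \<CC> (e(m := x, n := y)) \<phi>}"
    by (simp add: rel_of_def)
  ultimately show ?thesis
    using assms(1) unfolding definable_rels_def
    by (smt (verit, ccfv_threshold) lfm_rename mem_Collect_eq)
qed

section \<open>Closure properties of definable sets and relations\<close>

lemma definable_set_Compl:
  assumes "X \<in> definable_sets B" shows "dom \<CC> - X \<in> definable_sets B"
proof -
  obtain \<phi> e where "(\<phi>, e) \<in> pforms L B" "X = solutions \<CC> (\<phi>, e)"
    using assms by (auto simp: definable_sets_def)
  then have "(Neg \<phi>, e) \<in> pforms L B" "dom \<CC> - X = solutions \<CC> (Neg \<phi>, e)"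
    by (auto simp: pforms_def solutions_def)
  then show ?thesis by (auto simp: definable_sets_def)
qed

lemma dom_definable: "dom \<CC> \<in> definable_sets B"
proof -
  have "(Eq (Var 0) (Var 0), e) \<in> pforms L B" "solutions \<CC> (Eq (Var 0) (Var 0), e) = dom \<CC>" for e
    by (auto simp: pforms_def solutions_def)
  then show ?thesis unfolding definable_sets_def by (metis imageI)
qed

lemma singleton_definable:
  assumes "b \<in> B" "b \<in> dom \<CC>" shows "{b} \<in> definable_sets B"
proof -
  have "{x \<in> dom \<CC>. sat \<CC> ((\<lambda>_. b)(0 := x)) (Eq (Var 0) (Var 1))} \<in> definable_sets B"
    using assms by (intro definable_setI) auto
  moreover have "{x \<in> dom \<CC>. sat \<CC> ((\<lambda>_. b)(0 := x)) (Eq (Var 0) (Var 1))} = {b}"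
    using assms by auto
  ultimately show ?thesis by simp
qed

lemma Id_definable: "Id_on (dom \<CC>) \<in> definable_rels B"
proof -
  have "{(x, y). x \<in> dom \<CC> \<and> y \<in> dom \<CC> \<and> sat \<CC> (e(0 := x, 1 := y)) (Eq (Var 0) (Var 1))}
      \<in> definable_rels B" for e
    by (intro definable_relI) auto
  moreover have "{(x, y). x \<in> dom \<CC> \<and> y \<in> dom \<CC> \<and> sat \<CC> (e(0 := x, 1 := y)) (Eq (Var 0) (Var 1))}
      = Id_on (dom \<CC>)" for e
    by auto
  ultimately show ?thesis by simp
qed

lemma definable_rel_converse:
  assumes "R \<in> definable_rels B" shows "R\<inverse> \<in> definable_rels B"
proof -
  obtain \<phi> e where *: "lfm L \<phi>" "e ` (fv \<phi> - {0, 1}) \<subseteq> B" "R = rel_of \<phi> e"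
    using assms by (auto simp: definable_rels_def)
  have "{(x, y). x \<in> dom \<CC> \<and> y \<in> dom \<CC> \<and> sat \<CC> (e(1 := x, 0 := y)) \<phi>} \<in> definable_rels B"
    using * by (intro definable_relI) auto
  moreover have "{(x, y). x \<in> dom \<CC> \<and> y \<in> dom \<CC> \<and> sat \<CC> (e(1 := x, 0 := y)) \<phi>} = R\<inverse>"
    by (auto simp: * rel_of_def fun_upd_twist)
  ultimately show ?thesis by simp
qed

lemma definable_rel_Int:
  assumes "R \<in> definable_rels B" "S \<in> definable_rels B" shows "R \<inter> S \<in> definable_rels B"
proof -
  obtain \<phi> e where R: "lfm L \<phi>" "e ` (fv \<phi> - {0, 1}) \<subseteq> B" "R = rel_of \<phi> e"
    using assms by (auto simp: definable_rels_def)
  obtain \<psi> e' where S: "lfm L \<psi>" "e' ` (fv \<psi> - {0, 1}) \<subseteq> B" "S = rel_of \<psi> e'"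
    using assms by (auto simp: definable_rels_def)
  \<comment> \<open>The parameters of the two formulas are moved to even and odd variables above 1,
    so that the single assignment \<open>E\<close> can hold both; variables 0 and 1 stay
    shared.\<close>
  define \<rho> where "\<rho> = (\<lambda>v::nat. if v \<le> 1 then v else 2 * v)"
  define \<rho>' where "\<rho>' = (\<lambda>v::nat. if v \<le> 1 then v else 2 * v + 1)"
  have \<rho>: "inj \<rho>" "inj \<rho>'" by (auto simp: inj_def \<rho>_def \<rho>'_def)
  define E where "E = (\<lambda>v. if even v then e (v div 2) else e' (v div 2))"
  define \<theta> where "\<theta> = Conj (rename_fm \<rho> \<phi>) (rename_fm \<rho>' \<psi>)"
  have 1: "v \<in> {0, 1}" if "(v::nat) \<le> 1" for v using that by auto
  have "E (\<rho> v) \<in> B" if "v \<in> fv \<phi>" "\<rho> v \<notin> {0, 1}" for v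
    using that R(2) 1[of v] by (auto simp: \<rho>_def E_def split: if_splits)
  moreover have "E (\<rho>' v) \<in> B" if "v \<in> fv \<psi>" "\<rho>' v \<notin> {0, 1}" for v
    using that S(2) 1[of v] by (auto simp: \<rho>'_def E_def split: if_splits)
  ultimately have "E ` (fv \<theta> - {0, 1}) \<subseteq> B"
    by (auto simp: \<theta>_def fv_rename \<rho>)
  moreover
  have 2: "sat \<CC> (E(0 := x, 1 := y)) (rename_fm \<rho> \<phi>) \<longleftrightarrow> sat \<CC> (e(0 := x, 1 := y)) \<phi>" for x y
    unfolding sat_rename[OF \<rho>(1)] by (rule sat_cong) (auto simp: \<rho>_def E_def)
  have 3: "sat \<CC> (E(0 := x, 1 := y)) (rename_fm \<rho>' \<psi>) \<longleftrightarrow> sat \<CC> (e'(0 := x, 1 := y)) \<psi>" for x y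
    unfolding sat_rename[OF \<rho>(2)] by (rule sat_cong) (auto simp: \<rho>'_def E_def)
  have "R \<inter> S = rel_of \<theta> E"
    unfolding R(3) S(3) rel_of_def \<theta>_def sat.simps 2 3 by auto
  moreover have "lfm L \<theta>" by (simp add: \<theta>_def R S)
  ultimately show ?thesis unfolding definable_rels_def by blast
qed

text \<open>Products with the universe allow intersections, preimages and the counting of sets to be
  derived from facts on relations.\<close>

lemma definable_cylinder:
  assumes "X \<in> definable_sets B" shows "X \<times> dom \<CC> \<in> definable_rels B"
proof -
  obtain \<phi> e where *: "lfm L \<phi>" "e ` (fv \<phi> - {0}) \<subseteq> B" "X = solutions \<CC> (\<phi>, e)"
    using assms by (auto simp: definable_sets_def pforms_def)
  obtain n where n: "n \<notin> fv \<phi> \<union> {0}"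
    using finite_fv[of \<phi>] ex_new_if_finite[of "fv \<phi> \<union> {0}"] by auto
  have "{(x, y). x \<in> dom \<CC> \<and> y \<in> dom \<CC> \<and> sat \<CC> (e(0 := x, n := y)) \<phi>} \<in> definable_rels B"
    using * n by (intro definable_relI) auto
  moreover have "sat \<CC> (e(0 := x, n := y)) \<phi> \<longleftrightarrow> sat \<CC> (e(0 := x)) \<phi>" for x y
    using n by (intro sat_cong) auto
  then have "{(x, y). x \<in> dom \<CC> \<and> y \<in> dom \<CC> \<and> sat \<CC> (e(0 := x, n := y)) \<phi>} = X \<times> dom \<CC>"
    by (auto simp: * solutions_def)
  ultimately show ?thesis by simp
qed

lemma definable_Domain:
  assumes "R \<in> definable_rels B" shows "Domain R \<in> definable_sets B"
proof -
  obtain \<phi> e where *: "lfm L \<phi>" "e ` (fv \<phi> - {0, 1}) \<subseteq> B" "R = rel_of \<phi> e"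
    using assms by (auto simp: definable_rels_def)
  have "{x \<in> dom \<CC>. sat \<CC> (e(0 := x)) (Ex 1 \<phi>)} \<in> definable_sets B"
    using * by (intro definable_setI) auto
  moreover have "{x \<in> dom \<CC>. sat \<CC> (e(0 := x)) (Ex 1 \<phi>)} = Domain R"
    by (auto simp: * rel_of_def)
  ultimately show ?thesis by simp
qed

lemma definable_set_Int:
  assumes "X \<in> definable_sets B" "Y \<in> definable_sets B" shows "X \<inter> Y \<in> definable_sets B"
proof -
  have "Domain (X \<times> dom \<CC> \<inter> Y \<times> dom \<CC>) \<in> definable_sets B"
    using assms by (intro definable_Domain definable_rel_Int definable_cylinder)
  moreover have "Domain (X \<times> dom \<CC> \<inter> Y \<times> dom \<CC>) = X \<inter> Y"
    using is_struct by (auto simp: is_struct_def)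
  ultimately show ?thesis by simp
qed

lemma definable_preimage:
  assumes "R \<in> definable_rels B" "Z \<in> definable_sets B"
  shows "R\<inverse> `` Z \<in> definable_sets B"
proof -
  have "Domain (R \<inter> (Z \<times> dom \<CC>)\<inverse>) \<in> definable_sets B"
    using assms by (intro definable_Domain definable_rel_Int definable_cylinder definable_rel_converse)
  moreover have "Domain (R \<inter> (Z \<times> dom \<CC>)\<inverse>) = R\<inverse> `` Z"
    using definable_rel_subset[OF assms(1)] by auto
  ultimately show ?thesis by simp
qed

lemma definable_section:
  assumes "R \<in> definable_rels B" "b \<in> B" "b \<in> dom \<CC>"
  shows "R `` {b} \<in> definable_sets B"
  using definable_preimage[OF definable_rel_converse[OF assms(1)] singleton_definable[OF assms(2,3)]]
  by simp

text \<open>Separates the parameter \<open>c\<close>. It may be the value of several variables, so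
  these are first merged into one fresh variable \<open>n\<close>; turning \<open>n\<close> into the
  second coordinate leaves only parameters from \<open>B\<close>.\<close>

lemma definable_insertE:
  assumes "X \<in> definable_sets (insert c B)" "c \<in> dom \<CC>"
  obtains R where "R \<in> definable_rels B" "X = R\<inverse> `` {c}"
proof -
  obtain \<phi> e where *: "lfm L \<phi>" "e ` (fv \<phi> - {0}) \<subseteq> insert c B" "X = solutions \<CC> (\<phi>, e)"
    using assms by (auto simp: definable_sets_def pforms_def)
  obtain n where n: "n \<notin> fv \<phi> \<union> {0}"
    using finite_fv[of \<phi>] ex_new_if_finite[of "fv \<phi> \<union> {0}"] by auto
  define S where "S = {v \<in> fv \<phi> - {0}. e v = c}"
  have "finite S" "n \<notin> S" using n finite_fv[of \<phi>] by (auto simp: S_def)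
  from merge_variables[OF this *(1), of \<CC>] obtain \<psi> where \<psi>: "lfm L \<psi>" "fv \<psi> \<subseteq> (fv \<phi> - S) \<union> {n}"
    "\<And>E. E n \<in> dom \<CC> \<Longrightarrow> sat \<CC> E \<psi> \<longleftrightarrow> sat \<CC> (\<lambda>v. if v \<in> S then E n else E v) \<phi>"
    by auto
  let ?R = "{(x, y). x \<in> dom \<CC> \<and> y \<in> dom \<CC> \<and> sat \<CC> (e(0 := x, n := y)) \<psi>}"
  have "?R \<in> definable_rels B"
    using * \<psi> n by (intro definable_relI) (auto simp: S_def)
  moreover have "sat \<CC> (e(0 := x, n := c)) \<psi> \<longleftrightarrow> sat \<CC> (e(0 := x)) \<phi>" for x
  proof -
    have "sat \<CC> (\<lambda>v. if v \<in> S then (e(0 := x, n := c)) n else (e(0 := x, n := c)) v) \<phi> \<longleftrightarrow>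
        sat \<CC> (e(0 := x)) \<phi>"
      using n by (intro sat_cong) (auto simp: S_def)
    then show ?thesis using \<psi>(3)[of "e(0 := x, n := c)"] assms(2) by simp
  qed
  then have "X = ?R\<inverse> `` {c}"
    using assms(2) by (auto simp: * solutions_def)
  ultimately show ?thesis using that by blast
qed

text \<open>A formula has only finitely many parameters, and finitely many elements of the union of
  a nonempty chain lie in one member.\<close>

lemma definable_sets_chain_Union:
  assumes "X \<in> definable_sets (\<Union>\<B>)" "\<B> \<noteq> {}"
    and chain: "\<And>A B. A \<in> \<B> \<Longrightarrow> B \<in> \<B> \<Longrightarrow> A \<subseteq> B \<or> B \<subseteq> A"
  shows "\<exists>B\<in>\<B>. X \<in> definable_sets B"
proof -
  obtain \<phi> e where *: "lfm L \<phi>" "e ` (fv \<phi> - {0}) \<subseteq> \<Union>\<B>" "X = solutions \<CC> (\<phi>, e)"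
    using assms by (auto simp: definable_sets_def pforms_def)
  have "\<exists>B\<in>\<B>. F \<subseteq> B" if "finite F" "F \<subseteq> \<Union>\<B>" for F
    using that
  proof (induction F rule: finite_induct)
    case empty
    then show ?case using assms(2) by auto
  next
    case (insert x F)
    then obtain A B where "A \<in> \<B>" "F \<subseteq> A" "B \<in> \<B>" "x \<in> B" by auto
    then show ?case using chain[of A B] by blast
  qed
  from this[of "e ` (fv \<phi> - {0})"] obtain B where "B \<in> \<B>" "e ` (fv \<phi> - {0}) \<subseteq> B"
    using * finite_fv[of \<phi>] by auto
  then show ?thesis using * by (auto simp: definable_sets_def pforms_def)
qed

lemma definable_sets_mono_Union:
  fixes F :: "nat \<Rightarrow> 'a set"
  assumes "mono F" "X \<in> definable_sets (\<Union>n. F n)"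
  shows "\<exists>n. X \<in> definable_sets (F n)"
proof -
  have "\<exists>B\<in>range F. X \<in> definable_sets B"
  proof (rule definable_sets_chain_Union)
    fix A B assume "A \<in> range F" "B \<in> range F"
    then obtain m n where "A = F m" "B = F n" by blast
    then show "A \<subseteq> B \<or> B \<subseteq> A"
      using monoD[OF assms(1)] nat_le_linear[of m n] by blast
  qed (use assms(2) in auto)
  then show ?thesis by blast
qed

lemma countable_definable_rels:
  assumes "countable_lang L" "countable B"
  shows "countable (definable_rels B)"
proof (cases "B = {}")
  case True
  have "definable_rels B \<subseteq> (\<lambda>\<phi>. rel_of \<phi> undefined) ` {\<phi>. lfm L \<phi>}"
  proof
    fix R assume "R \<in> definable_rels B"
    then obtain \<phi> e where *: "lfm L \<phi>" "fv \<phi> - {0, 1} = {}" "R = rel_of \<phi> e"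
      using True by (auto simp: definable_rels_def)
    have "sat \<CC> (e(0 := x, 1 := y)) \<phi> \<longleftrightarrow> sat \<CC> (undefined(0 := x, 1 := y)) \<phi>" for x y
      using *(2) by (intro sat_cong) auto
    then show "R \<in> (\<lambda>\<phi>. rel_of \<phi> undefined) ` {\<phi>. lfm L \<phi>}"
      using * by (auto simp: rel_of_def)
  qed
  then show ?thesis
    using countable_lfm[OF assms(1)] by (meson countable_image countable_subset)
next
  case False
  then obtain b where b: "b \<in> B" by auto
  have "definable_rels B \<subseteq> (\<lambda>(\<phi>, bs). rel_of \<phi> (\<lambda>n. bs ! n)) ` ({\<phi>. lfm L \<phi>} \<times> lists B)"
  proof
    fix R assume "R \<in> definable_rels B"
    then obtain \<phi> e where *: "lfm L \<phi>" "e ` (fv \<phi> - {0, 1}) \<subseteq> B" "R = rel_of \<phi> e"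
      by (auto simp: definable_rels_def)
    obtain N where N: "\<And>v. v \<in> fv \<phi> \<Longrightarrow> v < N"
      using finite_fv[of \<phi>] finite_nat_set_iff_bounded by auto
    \<comment> \<open>The assignment is coded by the list of its values below \<open>N\<close>. The
      default \<open>b\<close> replaces values outside \<open>B\<close>, which can occur only where
      they are irrelevant: at variables 0 and 1 or at variables not free in
      \<open>\<phi>\<close>.\<close>
    define bs where "bs = map (\<lambda>v. if e v \<in> B then e v else b) [0..<N]"
    have "sat \<CC> (e(0 := x, 1 := y)) \<phi> \<longleftrightarrow> sat \<CC> ((\<lambda>n. bs ! n)(0 := x, 1 := y)) \<phi>" for x y
      using *(2) N by (intro sat_cong) (auto simp: bs_def)
    then have "R = rel_of \<phi> (\<lambda>n. bs ! n)" by (simp add: * rel_of_def)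
    moreover have "bs \<in> lists B" using b by (auto simp: bs_def)
    ultimately show "R \<in> (\<lambda>(\<phi>, bs). rel_of \<phi> (\<lambda>n. bs ! n)) ` ({\<phi>. lfm L \<phi>} \<times> lists B)"
      using *(1) by auto
  qed
  moreover have "countable ({\<phi>. lfm L \<phi>} \<times> lists B)"
    using countable_lfm[OF assms(1)] assms(2) by blast
  ultimately show ?thesis by (meson countable_image countable_subset)
qed

lemma countable_definable_sets:
  assumes "countable_lang L" "countable B"
  shows "countable (definable_sets B)"
proof (rule countable_subset)
  show "definable_sets B \<subseteq> Domain ` definable_rels B"
  proof
    fix X assume "X \<in> definable_sets B"
    moreover have "Domain (X \<times> dom \<CC>) = X" using is_struct by (auto simp: is_struct_def)
    ultimately show "X \<in> Domain ` definable_rels B" using definable_cylinder by (metis imageI)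
  qed
qed (use countable_definable_rels[OF assms] in blast)

section \<open>Elementary substructures\<close>

text \<open>The Tarski-Vaught criterion for \<open>N\<close> to be the universe of an elementary
  substructure. In terms of definable sets, no formula has to be evaluated in the smaller
  structure.\<close>

definition tarski_vaught :: "'a set \<Rightarrow> bool" where
  "tarski_vaught N \<longleftrightarrow> N \<subseteq> dom \<CC> \<and> (\<forall>Z\<in>definable_sets N. Z \<noteq> {} \<longrightarrow> Z \<inter> N \<noteq> {})"

lemma tarski_vaughtD:
  "tarski_vaught N \<Longrightarrow> Z \<in> definable_sets N \<Longrightarrow> Z \<noteq> {} \<Longrightarrow> Z \<inter> N \<noteq> {}"
  by (simp add: tarski_vaught_def)

lemma evalt_dom_update [simp]: "evalt (\<CC>\<lparr>dom := N\<rparr>) e t = evalt \<CC> e t"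
  by (induction t) (auto intro!: arg_cong[where f = "fint \<CC> _"])

lemma tarski_vaught_sat:
  assumes "tarski_vaught N" "lfm L \<phi>" "e ` fv \<phi> \<subseteq> N"
  shows "sat (\<CC>\<lparr>dom := N\<rparr>) e \<phi> \<longleftrightarrow> sat \<CC> e \<phi>"
  using assms(2,3)
proof (induction \<phi> arbitrary: e)
  case (Rel r ts)
  have "map (evalt (\<CC>\<lparr>dom := N\<rparr>) e) ts = map (evalt \<CC> e) ts" by simp
  then show ?case by (simp del: map_eq_conv)
next
  case (Conj \<phi> \<psi>)
  then show ?case by (simp add: image_Un)
next
  case (Ex n \<phi>)
  let ?Z = "{x \<in> dom \<CC>. sat \<CC> (e(n := x)) \<phi>}"
  have "?Z \<in> definable_sets N" using Ex.prems by (intro definable_setI) auto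
  then have "?Z \<noteq> {} \<longleftrightarrow> ?Z \<inter> N \<noteq> {}"
    using assms(1) by (auto simp: tarski_vaught_def)
  moreover have "sat (\<CC>\<lparr>dom := N\<rparr>) (e(n := x)) \<phi> \<longleftrightarrow> sat \<CC> (e(n := x)) \<phi>" if "x \<in> N" for x
    using Ex.prems that by (intro Ex.IH) auto
  moreover have "N \<subseteq> dom \<CC>" using assms(1) by (simp add: tarski_vaught_def)
  ultimately show ?case by auto
qed simp_all

lemma tarski_vaught_is_struct:
  assumes "tarski_vaught N" shows "is_struct L (\<CC>\<lparr>dom := N\<rparr>)"
  unfolding is_struct_def
proof (intro conjI ballI impI)
  have "dom \<CC> \<noteq> {}" using is_struct by (simp add: is_struct_def)
  then show "dom (\<CC>\<lparr>dom := N\<rparr>) \<noteq> {}"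
    using assms dom_definable[of N] by (auto simp: tarski_vaught_def)
next
  fix f xs assume f: "f \<in> fun_syms L" and xs: "xs \<in> lists (dom (\<CC>\<lparr>dom := N\<rparr>))"
    and len: "length xs = fun_ar L f"
  have N: "N \<subseteq> dom \<CC>" using assms by (simp add: tarski_vaught_def)
  have "xs \<in> lists (dom \<CC>)" using xs N by auto
  then have y: "fint \<CC> f xs \<in> dom \<CC>"
    using is_struct f len unfolding is_struct_def by blast
  \<comment> \<open>The value of \<open>f\<close> at \<open>xs\<close> is the only solution of an
    equation over \<open>N\<close>, so the criterion puts it into \<open>N\<close>. Variable 0 is
    the unknown and variable \<open>Suc i\<close> holds \<open>xs ! i\<close>.\<close>
  define \<phi> :: "('f, 'r) fm" where
    "\<phi> = Eq (Var 0) (Fn f (map (\<lambda>i. Var (Suc i)) [0..<length xs]))"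
  have ev: "map (evalt \<CC> ((\<lambda>v. xs ! (v - 1))(0 := x)) \<circ> (\<lambda>i. Var (Suc i))) [0..<length xs] = xs" for x
    by (rule nth_equalityI) auto
  have "{x \<in> dom \<CC>. sat \<CC> ((\<lambda>v. xs ! (v - 1))(0 := x)) \<phi>} \<in> definable_sets N"
    using f len xs by (intro definable_setI) (auto simp: \<phi>_def in_lists_conv_set)
  moreover have "{x \<in> dom \<CC>. sat \<CC> ((\<lambda>v. xs ! (v - 1))(0 := x)) \<phi>} = {fint \<CC> f xs}"
    using y ev by (auto simp: \<phi>_def simp del: map_eq_conv)
  ultimately have "{fint \<CC> f xs} \<in> definable_sets N" by simp
  then have "{fint \<CC> f xs} \<inter> N \<noteq> {}" by (intro tarski_vaughtD[OF assms]) auto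
  then show "fint (\<CC>\<lparr>dom := N\<rparr>) f xs \<in> dom (\<CC>\<lparr>dom := N\<rparr>)"
    by simp
qed

lemma tarski_vaught_is_model:
  assumes "tarski_vaught N" "T \<subseteq> sentences L" "is_model L \<CC> T"
  shows "is_model L (\<CC>\<lparr>dom := N\<rparr>) T"
  using assms tarski_vaught_is_struct tarski_vaught_sat
  by (auto simp: is_model_def sentences_def subset_iff)

lemma tarski_vaught_solutions:
  assumes "tarski_vaught N" "\<theta> \<in> pforms L N"
  shows "solutions (\<CC>\<lparr>dom := N\<rparr>) \<theta> = solutions \<CC> \<theta> \<inter> N"
proof -
  obtain \<phi> e where \<theta>: "\<theta> = (\<phi>, e)" by (cases \<theta>)
  have "sat (\<CC>\<lparr>dom := N\<rparr>) (e(0 := c)) \<phi> \<longleftrightarrow> sat \<CC> (e(0 := c)) \<phi>" if "c \<in> N" for c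
    using assms that by (intro tarski_vaught_sat) (auto simp: \<theta> pforms_def)
  then show ?thesis
    using assms(1) by (auto simp: \<theta> solutions_def tarski_vaught_def)
qed

lemma tarski_vaught_chain_Union:
  assumes "\<And>N. N \<in> \<N> \<Longrightarrow> tarski_vaught N" "\<N> \<noteq> {}"
    and "\<And>A B. A \<in> \<N> \<Longrightarrow> B \<in> \<N> \<Longrightarrow> A \<subseteq> B \<or> B \<subseteq> A"
  shows "tarski_vaught (\<Union>\<N>)"
  unfolding tarski_vaught_def
proof (intro conjI ballI impI)
  show "\<Union>\<N> \<subseteq> dom \<CC>" using assms(1) by (auto simp: tarski_vaught_def)
  fix Z assume Z: "Z \<in> definable_sets (\<Union>\<N>)" "Z \<noteq> {}"
  then obtain N where N: "N \<in> \<N>" "Z \<in> definable_sets N"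
    using definable_sets_chain_Union[OF Z(1) assms(2,3)] by auto
  then show "Z \<inter> \<Union>\<N> \<noteq> {}"
    using tarski_vaughtD[OF assms(1)[OF N(1)] N(2) Z(2)] by blast
qed

text \<open>The downward Loewenheim-Skolem construction with a property \<open>Q\<close> kept along
  the way. It is applied with the trivial property to get a first countable model and with
  \<open>conservative M\<close> to extend a model.\<close>

lemma tarski_vaught_closure:
  fixes Q :: "'a set \<Rightarrow> bool"
  assumes lang: "countable_lang L"
    and B: "countable B" "B \<subseteq> dom \<CC>" "Q B"
    and add: "\<And>B Z. \<lbrakk>countable B; B \<subseteq> dom \<CC>; Q B; Z \<in> definable_sets B; Z \<noteq> {}\<rbrakk> \<Longrightarrow>
      \<exists>c\<in>Z. Q (insert c B)"
    and Un: "\<And>F :: nat \<Rightarrow> 'a set. \<lbrakk>mono F; \<And>n. Q (F n)\<rbrakk> \<Longrightarrow> Q (\<Union>n. F n)"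
  shows "\<exists>N. B \<subseteq> N \<and> countable N \<and> Q N \<and> tarski_vaught N"
proof -
  define G where "G B \<longleftrightarrow> countable B \<and> B \<subseteq> dom \<CC> \<and> Q B" for B
  have G_Un: "G (\<Union>n. F n)" if "mono F" "\<And>n. G (F n)" for F :: "nat \<Rightarrow> 'a set"
    using that Un[of F] by (auto simp: G_def)
  have step: "\<exists>B'. B \<subseteq> B' \<and> G B' \<and> (\<forall>Z\<in>definable_sets B. Z \<noteq> {} \<longrightarrow> Z \<inter> B' \<noteq> {})" if B: "G B" for B
  proof -
    \<comment> \<open>One pass: the countably many sets definable over \<open>B\<close> are
      enumerated, and a point of each nonempty one is added in turn.\<close>
    define z where "z = from_nat_into (definable_sets B)"
    have ne: "definable_sets B \<noteq> {}" using dom_definable[of B] by auto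
    have z: "z n \<in> definable_sets B" for n
      unfolding z_def using ne by (rule from_nat_into)
    have "\<exists>F. \<forall>n. (G (F n) \<and> B \<subseteq> F n) \<and> (F n \<subseteq> F (Suc n) \<and> (z n \<noteq> {} \<longrightarrow> z n \<inter> F (Suc n) \<noteq> {}))"
    proof (rule dependent_nat_choice)
      show "\<exists>A. G A \<and> B \<subseteq> A" using B by auto
      fix A n assume A: "G A \<and> B \<subseteq> A"
      show "\<exists>A'. (G A' \<and> B \<subseteq> A') \<and> A \<subseteq> A' \<and> (z n \<noteq> {} \<longrightarrow> z n \<inter> A' \<noteq> {})"
      proof (cases "z n = {}")
        case False
        have "z n \<in> definable_sets A" using z A definable_sets_mono by blast
        then obtain c where "c \<in> z n" "Q (insert c A)"
          using add[of A "z n"] A False unfolding G_def by blast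
        moreover have "c \<in> dom \<CC>" using \<open>c \<in> z n\<close> definable_set_subset[OF z] by blast
        ultimately show ?thesis using A by (intro exI[of _ "insert c A"]) (auto simp: G_def)
      qed (use A in auto)
    qed
    then obtain F where F: "\<And>n. G (F n)" "\<And>n. B \<subseteq> F n" "\<And>n. F n \<subseteq> F (Suc n)"
      "\<And>n. z n \<noteq> {} \<Longrightarrow> z n \<inter> F (Suc n) \<noteq> {}" by metis
    have "mono F" using F(3) by (simp add: mono_iff_le_Suc)
    moreover have "Z \<inter> (\<Union>n. F n) \<noteq> {}" if Z: "Z \<in> definable_sets B" "Z \<noteq> {}" for Z
    proof -
      obtain n where "Z = z n"
        using from_nat_into_surj[OF countable_definable_sets[OF lang] Z(1)] B
        by (auto simp: z_def G_def)
      then show ?thesis using F(4)[of n] Z(2) by auto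
    qed
    moreover have "B \<subseteq> (\<Union>n. F n)" using F(2) by blast
    ultimately show ?thesis using G_Un[of F] F(1) by blast
  qed
  \<comment> \<open>New points give new definable sets, so the pass is repeated infinitely often; a
    set definable over the union is definable over some stage and is met at the next one.\<close>
  have "\<exists>F. \<forall>n. (G (F n) \<and> B \<subseteq> F n) \<and>
      (F n \<subseteq> F (Suc n) \<and> (\<forall>Z\<in>definable_sets (F n). Z \<noteq> {} \<longrightarrow> Z \<inter> F (Suc n) \<noteq> {}))"
  proof (rule dependent_nat_choice)
    show "\<exists>A. G A \<and> B \<subseteq> A" using B by (auto simp: G_def)
    fix A n assume A: "G A \<and> B \<subseteq> A"
    obtain A' where "A \<subseteq> A'" "G A'" "\<forall>Z\<in>definable_sets A. Z \<noteq> {} \<longrightarrow> Z \<inter> A' \<noteq> {}"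
      using step[OF conjunct1[OF A]] by (elim exE conjE)
    moreover have "B \<subseteq> A'" using A \<open>A \<subseteq> A'\<close> by blast
    ultimately show "\<exists>A'. (G A' \<and> B \<subseteq> A') \<and> A \<subseteq> A' \<and> (\<forall>Z\<in>definable_sets A. Z \<noteq> {} \<longrightarrow> Z \<inter> A' \<noteq> {})"
      by (intro exI[of _ A'] conjI)
  qed
  then obtain F where F: "\<And>n. G (F n)" "\<And>n. B \<subseteq> F n" "\<And>n. F n \<subseteq> F (Suc n)"
      "\<And>n Z. Z \<in> definable_sets (F n) \<Longrightarrow> Z \<noteq> {} \<Longrightarrow> Z \<inter> F (Suc n) \<noteq> {}" by metis
  have mono: "mono F" using F(3) by (simp add: mono_iff_le_Suc)
  have G: "G (\<Union>n. F n)" using G_Un mono F(1) by blast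
  have "Z \<inter> (\<Union>n. F n) \<noteq> {}" if Z: "Z \<in> definable_sets (\<Union>n. F n)" "Z \<noteq> {}" for Z
  proof -
    obtain n where n: "Z \<in> definable_sets (F n)"
      using definable_sets_mono_Union[OF mono Z(1)] by blast
    show ?thesis using F(4)[OF n Z(2)] by blast
  qed
  then have "tarski_vaught (\<Union>n. F n)" using G by (simp add: tarski_vaught_def G_def)
  moreover have "B \<subseteq> (\<Union>n. F n)" using F(2) by blast
  moreover have "countable (\<Union>n. F n)" "Q (\<Union>n. F n)" using G unfolding G_def by blast+
  ultimately show ?thesis by blast
qed

end

section \<open>Strongly regular definable types\<close>

locale regular_type = ambient_structure L \<CC>
  for L :: "('f, 'r) lang" and \<CC> :: "('f, 'r, 'a) struct" +
  fixes \<kappa> :: "'k rel" and p :: "('f, 'r, 'a) pfm set"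
  assumes lang: "countable_lang L"
    and uncountable: "natLeq <o \<kappa>"
    and saturated: "saturated L \<kappa> \<CC>"
    and global: "global_type L \<CC> p"
    and nonalgebraic: "nonalgebraic \<CC> p"
    and definable: "definable_over_empty L \<CC> p"
    and regular: "strongly_regular L \<kappa> \<CC> p"
begin

section \<open>Large sets and generic elements\<close>

definition large :: "'a set \<Rightarrow> bool" where
  "large X \<longleftrightarrow> X \<in> solutions \<CC> ` p"

text \<open>The realisations of the restriction of \<open>p\<close> to \<open>B\<close>, as
  \<open>realises_iff_generic\<close> confirms for \<open>B\<close> inside the universe.\<close>

definition generic :: "'a set \<Rightarrow> 'a \<Rightarrow> bool" where
  "generic B a \<longleftrightarrow> a \<in> dom \<CC> \<and> (\<forall>X\<in>definable_sets B. large X \<longrightarrow> a \<in> X)"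

lemma pforms_mono: "B \<subseteq> B' \<Longrightarrow> pforms L B \<subseteq> pforms L B'"
  by (auto simp: pforms_def)

lemma countable_less: "countable B \<Longrightarrow> |B| <o \<kappa>"
  using uncountable ordLeq_ordLess_trans countable_card_le_natLeq by blast

lemma realised_pair:
  assumes "\<theta> \<in> p" "\<theta>' \<in> p"
  shows "solutions \<CC> \<theta> \<inter> solutions \<CC> \<theta>' \<noteq> {}"
proof -
  have "\<exists>c. realises \<CC> c {\<theta>, \<theta>'}"
    using global assms by (auto simp: global_type_def complete_type_def)
  then show ?thesis by (auto simp: realises_def)
qed

text \<open>This makes largeness a property of the solution set alone. If a formula with the same
  solutions is in \<open>p\<close> but \<open>\<theta>\<close> is not, then \<open>p\<close>
  contains the negation of \<open>\<theta>\<close>, and so two formulas without a common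
  solution.\<close>

lemma large_iff:
  assumes "\<theta> \<in> pforms L (dom \<CC>)"
  shows "large (solutions \<CC> \<theta>) \<longleftrightarrow> \<theta> \<in> p"
proof
  assume "large (solutions \<CC> \<theta>)"
  then obtain \<theta>' where \<theta>': "\<theta>' \<in> p" "solutions \<CC> \<theta> = solutions \<CC> \<theta>'" by (auto simp: large_def)
  obtain \<phi> e where \<theta>: "\<theta> = (\<phi>, e)" by (cases \<theta>)
  show "\<theta> \<in> p"
  proof (rule ccontr)
    assume "\<theta> \<notin> p"
    then have "(Neg \<phi>, e) \<in> p"
      using global assms by (auto simp: global_type_def complete_type_def \<theta>)
    from realised_pair[OF this \<theta>'(1)] \<theta>'(2)[symmetric] show False
      by (auto simp: solutions_def \<theta>)
  qed
qed (auto simp: large_def)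

lemma large_Int_nonempty: "large X \<Longrightarrow> large Y \<Longrightarrow> X \<inter> Y \<noteq> {}"
  using realised_pair by (auto simp: large_def)

lemma large_infinite: "large X \<Longrightarrow> infinite X"
  using nonalgebraic by (auto simp: large_def nonalgebraic_def)

lemma large_or_Compl:
  assumes "X \<in> definable_sets B" "B \<subseteq> dom \<CC>"
  shows "large X \<or> large (dom \<CC> - X)"
proof -
  obtain \<phi> e where *: "(\<phi>, e) \<in> pforms L B" "X = solutions \<CC> (\<phi>, e)"
    using assms(1) by (auto simp: definable_sets_def)
  then have "(\<phi>, e) \<in> p \<or> (Neg \<phi>, e) \<in> p"
    using global pforms_mono[OF assms(2)] by (auto simp: global_type_def complete_type_def)
  moreover have "dom \<CC> - X = solutions \<CC> (Neg \<phi>, e)" by (auto simp: * solutions_def)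
  ultimately show ?thesis by (auto simp: large_def *)
qed

lemma realises_iff_generic:
  assumes "B \<subseteq> dom \<CC>"
  shows "realises \<CC> a (restrict_type L p B) \<longleftrightarrow> generic B a"
proof -
  have "\<theta> \<in> p \<longleftrightarrow> large (solutions \<CC> \<theta>)" if "\<theta> \<in> pforms L B" for \<theta>
    using large_iff pforms_mono[OF assms] that by blast
  then show ?thesis
    unfolding realises_def generic_def restrict_type_def definable_sets_def by auto
qed

lemma complete_restrict:
  assumes "B \<subseteq> dom \<CC>"
  shows "complete_type L \<CC> B (restrict_type L p B)"
  unfolding complete_type_def
proof (intro conjI allI impI)
  fix q0 assume "q0 \<subseteq> restrict_type L p B" and fin: "finite q0"
  then have "q0 \<subseteq> p" by (simp add: restrict_type_def)
  then show "\<exists>c. realises \<CC> c q0"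
    using global fin by (simp add: global_type_def complete_type_def)
next
  show "\<forall>(\<phi>, e)\<in>pforms L B. (\<phi>, e) \<in> restrict_type L p B \<or> (Neg \<phi>, e) \<in> restrict_type L p B"
  proof clarify
    fix \<phi> e assume *: "(\<phi>, e) \<in> pforms L B" "(Neg \<phi>, e) \<notin> restrict_type L p B"
    then have "(Neg \<phi>, e) \<notin> p" by (auto simp: restrict_type_def pforms_def)
    moreover have "(\<phi>, e) \<in> pforms L (dom \<CC>)" using * pforms_mono[OF assms] by auto
    ultimately have "(\<phi>, e) \<in> p" using global by (auto simp: global_type_def complete_type_def)
    then show "(\<phi>, e) \<in> restrict_type L p B" using * by (simp add: restrict_type_def)
  qed
qed (simp add: restrict_type_def)

lemma complete_type_of:
  assumes "a \<in> dom \<CC>"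
  shows "complete_type L \<CC> B {\<theta> \<in> pforms L B. a \<in> solutions \<CC> \<theta>}"
  unfolding complete_type_def
proof (intro conjI allI impI)
  show "\<exists>c. realises \<CC> c q0" if "q0 \<subseteq> {\<theta> \<in> pforms L B. a \<in> solutions \<CC> \<theta>}" for q0
    using that assms by (intro exI[of _ a]) (auto simp: realises_def)
qed (use assms in \<open>auto simp: pforms_def solutions_def\<close>)

lemma generic_exists:
  assumes "countable B" "B \<subseteq> dom \<CC>"
  shows "\<exists>a. generic B a"
proof -
  obtain a where "realises \<CC> a (restrict_type L p B)"
    using saturated assms(2) countable_less[OF assms(1)] complete_restrict[OF assms(2)]
    unfolding saturated_def by blast
  then show ?thesis using realises_iff_generic[OF assms(2)] by blast
qed

text \<open>Nonalgebraicity enters here: a singleton is not large, so for \<open>a\<close> in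
  \<open>B\<close> the complement of \<open>{a}\<close> is a large set over \<open>B\<close>, and a
  generic \<open>a\<close> would have to lie in it.\<close>

lemma generic_notin:
  assumes "generic B a" "B \<subseteq> dom \<CC>"
  shows "a \<notin> B"
proof
  assume "a \<in> B"
  then have a: "{a} \<in> definable_sets B" using assms by (intro singleton_definable) auto
  then have "large (dom \<CC> - {a})" using large_or_Compl[OF a assms(2)] large_infinite by auto
  then show False using assms(1) definable_set_Compl[OF a] unfolding generic_def by blast
qed

lemma generic_antimono: "generic B a \<Longrightarrow> A \<subseteq> B \<Longrightarrow> generic A a"
  using definable_sets_mono unfolding generic_def by blast

text \<open>The use of strong regularity. Since \<open>c\<close> is not generic, the restriction of
  \<open>p\<close> to \<open>B\<close> has only one complete extension over
  \<open>insert c B\<close>; the type of \<open>a\<close> and the restriction of \<open>p\<close>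
  are both such extensions, so they coincide.\<close>

lemma generic_over_nongeneric:
  assumes "countable B" "B \<subseteq> dom \<CC>" "generic B a" "c \<in> dom \<CC>" "\<not> generic B c"
    and X: "X \<in> definable_sets (insert c B)" "a \<in> X"
  shows "large X"
proof -
  obtain \<theta> where \<theta>: "\<theta> \<in> pforms L (insert c B)" "X = solutions \<CC> \<theta>"
    using X by (auto simp: definable_sets_def)
  let ?q = "{\<theta> \<in> pforms L (insert c B). a \<in> solutions \<CC> \<theta>}"
  have a: "a \<in> dom \<CC>" using assms(3) by (simp add: generic_def)
  have "\<not> realises \<CC> c (restrict_type L p B)"
    using realises_iff_generic[OF assms(2)] assms(5) by simp
  then have "\<exists>!q. complete_type L \<CC> (B \<union> {c}) q \<and> restrict_type L p B \<subseteq> q"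
    using regular assms(2,4) countable_less[OF assms(1)] unfolding strongly_regular_def by metis
  then have "\<exists>!q. complete_type L \<CC> (insert c B) q \<and> restrict_type L p B \<subseteq> q"
    by simp
  then have unique: "q = q'"
    if "complete_type L \<CC> (insert c B) q" "restrict_type L p B \<subseteq> q"
      "complete_type L \<CC> (insert c B) q'" "restrict_type L p B \<subseteq> q'" for q q'
    using that by (metis (no_types))
  have "realises \<CC> a (restrict_type L p B)"
    using realises_iff_generic[OF assms(2)] assms(3) by simp
  then have "restrict_type L p B \<subseteq> ?q"
    by (auto simp: realises_def restrict_type_def pforms_def)
  moreover have "restrict_type L p B \<subseteq> restrict_type L p (insert c B)"
    by (auto simp: restrict_type_def pforms_def)
  moreover have "complete_type L \<CC> (insert c B) (restrict_type L p (insert c B))"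
    using assms(2,4) by (intro complete_restrict) auto
  ultimately have "?q = restrict_type L p (insert c B)"
    by (intro unique complete_type_of[OF a])
  then have "\<theta> \<in> p" using \<theta> X by (auto simp: restrict_type_def)
  then show ?thesis by (simp add: large_def \<theta>)
qed

text \<open>The use of definability: the formula \<open>d\<phi>\<close> attached to the formula of
  \<open>R\<close> defines this set, with the parameters of \<open>R\<close>.\<close>

lemma definable_large_sections:
  assumes "R \<in> definable_rels B" "B \<subseteq> dom \<CC>"
  shows "{y \<in> dom \<CC>. large (R\<inverse> `` {y})} \<in> definable_sets B"
proof -
  obtain \<phi> e where *: "lfm L \<phi>" "e ` (fv \<phi> - {0, 1}) \<subseteq> B" "R = rel_of \<phi> e"
    using assms by (auto simp: definable_rels_def)
  obtain d\<phi> where d: "lfm L d\<phi>" "fv d\<phi> \<subseteq> fv \<phi> - {0}"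
    "\<And>e. (\<phi>, e) \<in> pforms L (dom \<CC>) \<Longrightarrow> (\<phi>, e) \<in> p \<longleftrightarrow> sat \<CC> e d\<phi>"
    using definable *(1) unfolding definable_over_empty_def by metis
  have "{y \<in> dom \<CC>. sat \<CC> (e(1 := y)) d\<phi>} \<in> definable_sets B"
    using * d by (intro definable_setI) auto
  moreover have "large (R\<inverse> `` {y}) \<longleftrightarrow> sat \<CC> (e(1 := y)) d\<phi>" if y: "y \<in> dom \<CC>" for y
  proof -
    have mem: "(\<phi>, e(1 := y)) \<in> pforms L (dom \<CC>)"
      using * assms y by (auto simp: pforms_def)
    moreover have "R\<inverse> `` {y} = solutions \<CC> (\<phi>, e(1 := y))"
      using y by (auto simp: * rel_of_def solutions_def fun_upd_twist)
    ultimately show ?thesis using d(3) large_iff by metis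
  qed
  then have "{y \<in> dom \<CC>. sat \<CC> (e(1 := y)) d\<phi>} = {y \<in> dom \<CC>. large (R\<inverse> `` {y})}"
    by blast
  ultimately show ?thesis by simp
qed

text \<open>The formulas over \<open>B\<close> that hold on some \<open>Z n\<close> are finitely
  satisfiable, as the sequence decreases through nonempty sets, and complete by \<open>dec\<close>;
  saturation realises this type. So a construction in countably many steps yields an actual
  element.\<close>

lemma saturation_sequence:
  fixes Z :: "nat \<Rightarrow> 'a set"
  assumes "countable B" "B \<subseteq> dom \<CC>"
    and Z: "\<And>n. Z n \<noteq> {}" "\<And>n. Z n \<subseteq> dom \<CC>" "antimono Z"
    and dec: "\<And>W. W \<in> definable_sets B \<Longrightarrow> \<exists>n. Z n \<subseteq> W \<or> Z n \<inter> W = {}"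
  shows "\<exists>c\<in>dom \<CC>. \<forall>W\<in>definable_sets B. (\<exists>n. Z n \<subseteq> W) \<longrightarrow> c \<in> W"
proof -
  define q where "q = {\<theta> \<in> pforms L B. \<exists>n. Z n \<subseteq> solutions \<CC> \<theta>}"
  have common: "\<exists>n. \<forall>\<theta>\<in>F. Z n \<subseteq> solutions \<CC> \<theta>" if "finite F" "F \<subseteq> q" for F
    using that
  proof (induction F rule: finite_induct)
    case (insert \<theta> F)
    then obtain n m where "\<forall>\<theta>\<in>F. Z n \<subseteq> solutions \<CC> \<theta>" "Z m \<subseteq> solutions \<CC> \<theta>"
      by (auto simp: q_def)
    moreover have "Z (max n m) \<subseteq> Z n" "Z (max n m) \<subseteq> Z m"
      using antimonoD[OF Z(3)] by simp_all
    ultimately show ?case by (intro exI[of _ "max n m"]) auto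
  qed auto
  have fin: "\<exists>c. realises \<CC> c F" if F: "finite F" "F \<subseteq> q" for F
  proof -
    obtain n where n: "\<forall>\<theta>\<in>F. Z n \<subseteq> solutions \<CC> \<theta>"
      using common[OF F] by blast
    obtain c where "c \<in> Z n" using Z(1)[of n] by blast
    then show ?thesis using n Z(2)[of n] by (intro exI[of _ c]) (auto simp: realises_def)
  qed
  have compl: "(\<phi>, e) \<in> q \<or> (Neg \<phi>, e) \<in> q" if "(\<phi>, e) \<in> pforms L B" for \<phi> e
  proof -
    have "solutions \<CC> (\<phi>, e) \<in> definable_sets B" using that by (auto simp: definable_sets_def)
    then obtain n where "Z n \<subseteq> solutions \<CC> (\<phi>, e) \<or> Z n \<inter> solutions \<CC> (\<phi>, e) = {}"
      using dec[of "solutions \<CC> (\<phi>, e)"] by blast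
    moreover have "solutions \<CC> (Neg \<phi>, e) = dom \<CC> - solutions \<CC> (\<phi>, e)"
      by (auto simp: solutions_def)
    moreover have "(Neg \<phi>, e) \<in> pforms L B" using that by (simp add: pforms_def)
    ultimately show ?thesis using that Z(2)[of n] unfolding q_def by blast
  qed
  have "complete_type L \<CC> B q"
    using fin compl unfolding complete_type_def by (auto simp: q_def)
  then obtain c where "realises \<CC> c q"
    using saturated assms(1,2) countable_less unfolding saturated_def by blast
  then show ?thesis
    by (intro bexI[of _ c]) (auto simp: realises_def q_def definable_sets_def)
qed

section \<open>Conservative sets of parameters and omitting types\<close>

text \<open>A condition on \<open>B \<supseteq> M\<close> which forces every element of \<open>B\<close> outside \<open>M\<close> to be generic over \<open>M\<close>
  and which, unlike that, is preserved when adding suitable solutions of formulas over \<open>B\<close>.\<close>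

definition conservative :: "'a set \<Rightarrow> 'a set \<Rightarrow> bool" where
  "conservative M B \<longleftrightarrow> M \<subseteq> B \<and> (\<forall>X\<in>definable_sets B. \<forall>Y\<in>definable_sets M.
     \<not> large Y \<longrightarrow> X \<inter> Y \<noteq> {} \<longrightarrow> X \<inter> Y \<inter> M \<noteq> {})"

lemma conservativeD:
  "\<lbrakk>conservative M B; X \<in> definable_sets B; Y \<in> definable_sets M; \<not> large Y; X \<inter> Y \<noteq> {}\<rbrakk> \<Longrightarrow>
    X \<inter> Y \<inter> M \<noteq> {}"
  by (simp add: conservative_def)

text \<open>If \<open>b\<close> missed a large \<open>Y\<close>, the condition for the set
  \<open>{b}\<close> and the complement of \<open>Y\<close>, which is not large, would give a point
  of \<open>{b}\<close> in \<open>M\<close>.\<close>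

lemma conservative_generic:
  assumes "conservative M B" "M \<subseteq> dom \<CC>" "b \<in> B" "b \<in> dom \<CC>" "b \<notin> M"
  shows "generic M b"
proof (rule ccontr)
  assume "\<not> generic M b"
  then obtain Y where Y: "Y \<in> definable_sets M" "large Y" "b \<notin> Y"
    using assms by (auto simp: generic_def)
  have "\<not> large (dom \<CC> - Y)" using large_Int_nonempty[OF Y(2)] by blast
  moreover have "{b} \<in> definable_sets B" using assms by (intro singleton_definable)
  moreover have "{b} \<inter> (dom \<CC> - Y) \<noteq> {}" using assms Y by auto
  ultimately have "{b} \<inter> (dom \<CC> - Y) \<inter> M \<noteq> {}"
    by (intro conservativeD[OF assms(1)] definable_set_Compl[OF Y(1)])
  then show False using assms(5) by auto
qed

lemma conservative_insert_generic:
  assumes M: "countable M" "tarski_vaught M" and a: "generic M a"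
  shows "conservative M (insert a M)"
  unfolding conservative_def
proof (intro conjI ballI impI)
  fix X Y assume X: "X \<in> definable_sets (insert a M)" and Y: "Y \<in> definable_sets M" "\<not> large Y"
    and ne: "X \<inter> Y \<noteq> {}"
  have dom: "M \<subseteq> dom \<CC>" using M by (simp add: tarski_vaught_def)
  have "a \<in> dom \<CC>" using a by (simp add: generic_def)
  then obtain R where R: "R \<in> definable_rels M" "X = R\<inverse> `` {a}"
    using definable_insertE[OF X] by metis
  obtain c where c: "c \<in> X" "c \<in> Y" using ne by auto
  have c_dom: "c \<in> dom \<CC>" using definable_set_subset[OF Y(1)] c by auto
  \<comment> \<open>Membership in \<open>?S\<close> is the condition over \<open>M\<close> that
    replaces the reference to \<open>a\<close>: regularity puts \<open>c\<close> into it, and by the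
    Tarski-Vaught property some \<open>c'\<close> in \<open>M\<close> lies in both \<open>?S\<close>
    and \<open>Y\<close>.\<close>
  let ?S = "{y \<in> dom \<CC>. large (R `` {y})}"
  have S: "?S \<in> definable_sets M"
    using definable_large_sections[OF definable_rel_converse[OF R(1)] dom] by simp
  \<comment> \<open>The complement of \<open>Y\<close> is large and misses \<open>c\<close>.\<close>
  have "\<not> generic M c"
    using large_or_Compl[OF Y(1) dom] Y definable_set_Compl[OF Y(1)] c by (auto simp: generic_def)
  moreover have "R `` {c} \<in> definable_sets (insert c M)"
    using R(1) definable_rels_mono[of M "insert c M"] c_dom by (intro definable_section) auto
  moreover have "a \<in> R `` {c}" using c R by auto
  ultimately have "large (R `` {c})"
    using generic_over_nongeneric[OF M(1) dom a c_dom] by blast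
  then have "?S \<inter> Y \<noteq> {}" using c c_dom by auto
  then have "?S \<inter> Y \<inter> M \<noteq> {}"
    by (intro tarski_vaughtD[OF M(2)] definable_set_Int[OF S Y(1)])
  then obtain c' where c': "c' \<in> Y" "c' \<in> M" "large (R `` {c'})" by auto
  have "R `` {c'} \<in> definable_sets M" using R(1) c' dom by (intro definable_section) auto
  then have "a \<in> R `` {c'}" using a c'(3) unfolding generic_def by blast
  then show "X \<inter> Y \<inter> M \<noteq> {}" using R c' by auto
qed auto

lemma conservative_chain_Union:
  fixes F :: "nat \<Rightarrow> 'a set"
  assumes "mono F" "\<And>n. conservative M (F n)"
  shows "conservative M (\<Union>n. F n)"
  unfolding conservative_def
proof (intro conjI ballI impI)
  show "M \<subseteq> (\<Union>n. F n)" using assms(2)[of 0] by (auto simp: conservative_def)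
  fix X Y assume *: "X \<in> definable_sets (\<Union>n. F n)" "Y \<in> definable_sets M" "\<not> large Y" "X \<inter> Y \<noteq> {}"
  obtain n where "X \<in> definable_sets (F n)"
    using definable_sets_mono_Union[OF assms(1) *(1)] by blast
  then show "X \<inter> Y \<inter> M \<noteq> {}" by (intro conservativeD[OF assms(2)] *)
qed

text \<open>The omitting types argument: a type over \<open>B\<close> containing \<open>Z\<close> is built such that for all
  \<open>R\<close> and all non-large \<open>Y\<close>, its realisation \<open>c\<close> either has no \<open>R\<close>-predecessor in \<open>Y\<close> or has one
  in \<open>Y \<inter> M\<close>.\<close>

lemma conservative_insert:
  assumes B: "countable B" "B \<subseteq> dom \<CC>" and cons: "conservative M B"
    and Z: "Z \<in> definable_sets B" "Z \<noteq> {}"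
  shows "\<exists>c\<in>Z. conservative M (insert c B)"
proof -
  have MB: "M \<subseteq> B" using cons by (simp add: conservative_def)
  \<comment> \<open>A triple stands for one task: \<open>R\<close> and \<open>Y\<close> for a type
    to be omitted, \<open>W\<close> for a set to be decided, which makes the resulting type
    complete.\<close>
  define I where
    "I = definable_rels B \<times> {Y \<in> definable_sets M. \<not> large Y} \<times> definable_sets B"
  \<comment> \<open>The empty set can fill the slot of \<open>Y\<close>, so that \<open>I\<close> is
    nonempty and can be enumerated.\<close>
  have "{} \<in> definable_sets M" using definable_set_Compl[OF dom_definable] by simp
  then have "I \<noteq> {}"
    using Id_definable dom_definable large_infinite[of "{}"] unfolding I_def by blast
  have "countable M" using MB B(1) by (rule countable_subset)
  then have "countable {Y \<in> definable_sets M. \<not> large Y}"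
    by (intro countable_Collect countable_definable_sets[OF lang])
  then have "countable I"
    unfolding I_def
    using countable_definable_rels[OF lang B(1)] countable_definable_sets[OF lang B(1)]
    by (intro countable_SIGMA)
  define i where "i = from_nat_into I"
  have i: "range i = I"
    unfolding i_def using \<open>I \<noteq> {}\<close> \<open>countable I\<close> by (rule range_from_nat_into)
  define good where "good Z' = (\<lambda>(R, Y, W).
    (Y \<inter> R\<inverse> `` Z' = {} \<or> (\<exists>c'\<in>Y \<inter> M. Z' \<subseteq> R `` {c'})) \<and> (Z' \<subseteq> W \<or> Z' \<inter> W = {}))" for Z' :: "'a set"
  define ok where "ok A \<longleftrightarrow> A \<in> definable_sets B \<and> A \<noteq> {} \<and> A \<subseteq> Z" for A
  have "\<exists>F. \<forall>n. ok (F n) \<and> (F (Suc n) \<subseteq> F n \<and> good (F (Suc n)) (i n))"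
  proof (rule dependent_nat_choice)
    show "\<exists>A. ok A" using Z by (auto simp: ok_def)
    fix A n assume A: "ok A"
    have "i n \<in> I" using i by auto
    then obtain R Y W where RYW: "i n = (R, Y, W)" "R \<in> definable_rels B" "Y \<in> definable_sets M"
        "\<not> large Y" "W \<in> definable_sets B"
      by (auto simp: I_def)
    obtain A' where A': "ok A'" "A' \<subseteq> A"
      "Y \<inter> R\<inverse> `` A' = {} \<or> (\<exists>c'\<in>Y \<inter> M. A' \<subseteq> R `` {c'})"
    proof (cases "R\<inverse> `` A \<inter> Y = {}")
      case True
      then show ?thesis using that[of A] A by auto
    next
      case False
      moreover have "R\<inverse> `` A \<in> definable_sets B"
        using A RYW by (intro definable_preimage) (auto simp: ok_def)
      ultimately have "R\<inverse> `` A \<inter> Y \<inter> M \<noteq> {}"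
        using RYW by (intro conservativeD[OF cons])
      \<comment> \<open>Conservativity of \<open>B\<close> has moved a predecessor of some point of
        \<open>A\<close> into \<open>M\<close>. Cutting \<open>A\<close> down to the successors of
        \<open>c'\<close> keeps that predecessor for the rest of the construction.\<close>
      then obtain c' where c': "c' \<in> Y \<inter> M" "A \<inter> R `` {c'} \<noteq> {}" by auto
      then have "R `` {c'} \<in> definable_sets B"
        using RYW MB B by (intro definable_section) auto
      then have "ok (A \<inter> R `` {c'})"
        using A c' definable_set_Int by (auto simp: ok_def)
      then show ?thesis using that[of "A \<inter> R `` {c'}"] c' by auto
    qed
    obtain A'' where A'': "ok A''" "A'' \<subseteq> A'" "A'' \<subseteq> W \<or> A'' \<inter> W = {}"
    proof (cases "A' \<inter> W = {}")
      case True
      then show ?thesis using that[of A'] A' by auto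
    next
      case False
      then have "ok (A' \<inter> W)" using A' RYW definable_set_Int by (auto simp: ok_def)
      then show ?thesis using that[of "A' \<inter> W"] by auto
    qed
    have "Y \<inter> R\<inverse> `` A'' = {} \<or> (\<exists>c'\<in>Y \<inter> M. A'' \<subseteq> R `` {c'})"
      using A'(3) Image_mono[OF subset_refl A''(2), of "R\<inverse>"] A''(2) by (meson disjoint_iff subset_iff)
    then have "good A'' (i n)" using A''(3) by (simp add: good_def RYW)
    then show "\<exists>A'. ok A' \<and> A' \<subseteq> A \<and> good A' (i n)"
      using A''(1,2) A'(2) by (intro exI[of _ A'']) auto
  qed
  then obtain F where "\<forall>n. ok (F n) \<and> (F (Suc n) \<subseteq> F n \<and> good (F (Suc n)) (i n))"
    by (elim exE)
  then have F: "\<And>n. ok (F n)" "\<And>n. F (Suc n) \<subseteq> F n" "\<And>n. good (F (Suc n)) (i n)"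
    by simp_all
  have "\<exists>c\<in>dom \<CC>. \<forall>W\<in>definable_sets B. (\<exists>n. F n \<subseteq> W) \<longrightarrow> c \<in> W"
  proof (rule saturation_sequence[OF B])
    show "antimono F" using F(2) by (simp add: antimono_iff_le_Suc)
    fix W assume "W \<in> definable_sets B"
    \<comment> \<open>Any admissible \<open>R\<close> and \<open>Y\<close> complete the triple; the
      task with third entry \<open>W\<close> decides \<open>W\<close>.\<close>
    moreover obtain R Y where "R \<in> definable_rels B" "Y \<in> definable_sets M" "\<not> large Y"
      using \<open>I \<noteq> {}\<close> by (auto simp: I_def)
    ultimately have "(R, Y, W) \<in> range i" using i by (auto simp: I_def)
    then obtain n where "i n = (R, Y, W)" by force
    then show "\<exists>n. F n \<subseteq> W \<or> F n \<inter> W = {}"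
      using F(3)[of n] by (intro exI[of _ "Suc n"]) (simp add: good_def)
  next
    show "F n \<noteq> {}" "F n \<subseteq> dom \<CC>" for n
      using F(1)[of n] by (auto simp: ok_def dest: definable_set_subset)
  qed
  then obtain c where c: "c \<in> dom \<CC>" "\<And>n W. W \<in> definable_sets B \<Longrightarrow> F n \<subseteq> W \<Longrightarrow> c \<in> W"
    by blast
  \<comment> \<open>Each \<open>F n\<close> is itself definable over \<open>B\<close>, so it belongs
    to the type realised by \<open>c\<close>.\<close>
  have cF: "c \<in> F n" for n using c(2)[of "F n" n] F(1)[of n] by (auto simp: ok_def)
  have "conservative M (insert c B)"
    unfolding conservative_def
  proof (intro conjI ballI impI)
    fix X Y assume X: "X \<in> definable_sets (insert c B)" and Y: "Y \<in> definable_sets M" "\<not> large Y"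
      and ne: "X \<inter> Y \<noteq> {}"
    obtain R where R: "R \<in> definable_rels B" "X = R\<inverse> `` {c}"
      using definable_insertE[OF X c(1)] by metis
    \<comment> \<open>The slot of \<open>W\<close> is filled with the whole universe. Of the two
      alternatives for \<open>R\<close> and \<open>Y\<close> the first fails, because
      \<open>c\<close> lies in \<open>F (Suc n)\<close> and has a predecessor in
      \<open>Y\<close>.\<close>
    then have "(R, Y, dom \<CC>) \<in> range i" using Y dom_definable i by (auto simp: I_def)
    then obtain n where "i n = (R, Y, dom \<CC>)" by force
    then have "Y \<inter> R\<inverse> `` F (Suc n) = {} \<or> (\<exists>c'\<in>Y \<inter> M. F (Suc n) \<subseteq> R `` {c'})"
      using F(3)[of n] by (simp add: good_def)
    moreover have "Y \<inter> R\<inverse> `` F (Suc n) \<noteq> {}" using ne R cF by blast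
    ultimately obtain c' where "c' \<in> Y \<inter> M" "F (Suc n) \<subseteq> R `` {c'}" by blast
    then show "X \<inter> Y \<inter> M \<noteq> {}" using cF[of "Suc n"] R by blast
  qed (use MB in auto)
  moreover have "c \<in> Z" using cF[of 0] F(1)[of 0] by (auto simp: ok_def)
  ultimately show ?thesis by blast
qed

section \<open>Maximal chains of generic extensions\<close>

definition generic_extension :: "'a set \<Rightarrow> 'a set \<Rightarrow> bool" where
  "generic_extension M N \<longleftrightarrow> M \<subset> N \<and> (\<forall>b\<in>N - M. generic M b)"

text \<open>A generic \<open>a\<close> is adjoined to \<open>M\<close>, and the closure keeps the
  set conservative, so that all new elements are generic; \<open>a\<close> itself makes the
  extension proper.\<close>

lemma generic_extension_exists:
  assumes "countable M" "tarski_vaught M"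
  shows "\<exists>N. countable N \<and> tarski_vaught N \<and> generic_extension M N"
proof -
  have dom: "M \<subseteq> dom \<CC>" using assms by (simp add: tarski_vaught_def)
  obtain a where a: "generic M a" using generic_exists[OF assms(1) dom] by (elim exE)
  then have a_dom: "a \<in> dom \<CC>" by (simp add: generic_def)
  have "\<exists>N. insert a M \<subseteq> N \<and> countable N \<and> conservative M N \<and> tarski_vaught N"
  proof (rule tarski_vaught_closure[OF lang])
    show "countable (insert a M)" "insert a M \<subseteq> dom \<CC>" using assms(1) dom a_dom by auto
    show "conservative M (insert a M)" using assms a by (rule conservative_insert_generic)
  qed (rule conservative_insert conservative_chain_Union; assumption)+
  then obtain N where N: "insert a M \<subseteq> N" "countable N" "conservative M N" "tarski_vaught N" by blast
  have "generic M b" if "b \<in> N - M" for b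
    using N conservative_generic[OF N(3) dom, of b] that by (auto simp: tarski_vaught_def)
  moreover have "a \<notin> M" using a dom by (rule generic_notin)
  ultimately have "generic_extension M N" using N(1) unfolding generic_extension_def by blast
  then show ?thesis using N by blast
qed

lemma quasiminimal_substructure:
  "\<exists>N. tarski_vaught N \<and> quasiminimal L (\<CC>\<lparr>dom := N\<rparr>)"
proof -
  define \<M> where "\<M> = {M. countable M \<and> tarski_vaught M}"
  \<comment> \<open>Hausdorff's maximal principle stands in for a transfinite construction of length
    omega_1.\<close>
  obtain \<N> where max: "pred_on.maxchain \<M> generic_extension \<N>"
    using pred_on.Hausdorff[of \<M> generic_extension] by (elim exE)
  then have chain: "pred_on.chain \<M> generic_extension \<N>"
    by (rule pred_on.maxchain_imp_chain)
  then have \<N>: "\<And>N. N \<in> \<N> \<Longrightarrow> countable N" "\<And>N. N \<in> \<N> \<Longrightarrow> tarski_vaught N"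
    and lin: "\<And>A B. A \<in> \<N> \<Longrightarrow> B \<in> \<N> \<Longrightarrow> A = B \<or> generic_extension A B \<or> generic_extension B A"
    unfolding pred_on.chain_def \<M>_def by auto
  have no_extension: False
    if "N \<in> \<M>" "N \<notin> \<N>" "\<And>A. A \<in> \<N> \<Longrightarrow> generic_extension A N" for N
  proof -
    have "pred_on.chain \<M> generic_extension (insert N \<N>)"
      using chain that unfolding pred_on.chain_def by auto
    then show False using max that(2) unfolding pred_on.maxchain_def by blast
  qed
  have ne: "\<N> \<noteq> {}"
  proof
    assume "\<N> = {}"
    moreover have "\<exists>N. {} \<subseteq> N \<and> countable N \<and> True \<and> tarski_vaught N"
      by (rule tarski_vaught_closure[OF lang]) auto
    ultimately show False using no_extension by (auto simp: \<M>_def)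
  qed
  define U where "U = \<Union>\<N>"
  have U_tv: "tarski_vaught U"
    unfolding U_def using \<N>(2) ne lin
    by (intro tarski_vaught_chain_Union) (auto simp: generic_extension_def)
  \<comment> \<open>Such a \<open>b\<close> lies in a later member of the chain, which is a generic
    extension of \<open>N\<close>.\<close>
  have generic_U: "generic N b" if N: "N \<in> \<N>" and b: "b \<in> U - N" for N b
  proof -
    obtain A where "A \<in> \<N>" "b \<in> A" using b by (auto simp: U_def)
    then have "generic_extension N A"
      using lin[OF N] b by (auto simp: generic_extension_def)
    then show ?thesis using \<open>b \<in> A\<close> b by (auto simp: generic_extension_def)
  qed
  have "uncountable U"
  proof
    assume "countable U"
    \<comment> \<open>A generic extension of a countable \<open>U\<close> would lie above every
      member \<open>A\<close> of the chain: its elements outside \<open>A\<close> are either new and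
      generic over \<open>U\<close>, hence over \<open>A\<close>, or lie in \<open>U\<close> and are
      covered by \<open>generic_U\<close>.\<close>
    then obtain N where N: "countable N" "tarski_vaught N" "generic_extension U N"
      using generic_extension_exists U_tv by blast
    have "generic_extension A N" if A: "A \<in> \<N>" for A
    proof -
      have "A \<subseteq> U" using A by (auto simp: U_def)
      then show ?thesis
        using N(3) generic_U[OF A] generic_antimono[of U _ A] by (auto simp: generic_extension_def)
    qed
    moreover have "N \<notin> \<N>" using N(3) by (auto simp: generic_extension_def U_def)
    ultimately show False using no_extension[of N] N by (auto simp: \<M>_def)
  qed
  moreover have "countable (solutions (\<CC>\<lparr>dom := U\<rparr>) \<theta>) \<or>
      countable (U - solutions (\<CC>\<lparr>dom := U\<rparr>) \<theta>)" if \<theta>: "\<theta> \<in> pforms L U" for \<theta>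
  proof -
    let ?X = "solutions \<CC> \<theta>"
    have "?X \<in> definable_sets (\<Union>\<N>)"
      using \<theta> by (auto simp: definable_sets_def U_def)
    then have "\<exists>N\<in>\<N>. ?X \<in> definable_sets N"
      using ne lin by (intro definable_sets_chain_Union) (auto simp: generic_extension_def)
    then obtain N where N: "N \<in> \<N>" and X: "?X \<in> definable_sets N" by blast
    have U: "U \<subseteq> dom \<CC>" using U_tv by (simp add: tarski_vaught_def)
    \<comment> \<open>The set is definable over one countable model \<open>N\<close> of the chain.
      It or its complement is large and contains every point of \<open>U\<close> outside
      \<open>N\<close>, so the other one meets \<open>U\<close> only inside
      \<open>N\<close>.\<close>
    then have "large ?X \<or> large (dom \<CC> - ?X)"
      using N by (intro large_or_Compl[OF X]) (auto simp: U_def)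
    then have "U - ?X \<subseteq> N \<or> ?X \<inter> U \<subseteq> N"
      using generic_U[OF N] X definable_set_Compl[OF X] unfolding generic_def by blast
    then have "countable (U - ?X) \<or> countable (?X \<inter> U)"
      using countable_subset[OF _ \<N>(1)[OF N], of "U - ?X"]
        countable_subset[OF _ \<N>(1)[OF N], of "?X \<inter> U"] by argo
    moreover have "U - ?X \<inter> U = U - ?X" by blast
    ultimately show ?thesis
      unfolding tarski_vaught_solutions[OF U_tv \<theta>] by auto
  qed
  ultimately have "quasiminimal L (\<CC>\<lparr>dom := U\<rparr>)" by (simp add: quasiminimal_def)
  then show ?thesis using U_tv by blast
qed

end

theorem theorem3p3:
  fixes L :: "('f, 'r) lang"
    and T :: "('f, 'r) fm set"
    and \<kappa> :: "'k rel"
    and \<CC> :: "('f, 'r, 'a) struct"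
    and p :: "('f, 'r, 'a) pfm set"
  assumes "countable_lang L"
    and "complete_theory L T"
    and "monster_model L T \<kappa> \<CC>"
    and "global_type L \<CC> p"
    and "nonalgebraic \<CC> p"
    and "definable_over_empty L \<CC> p"
    and "strongly_regular L \<kappa> \<CC> p"
  shows "\<exists>M :: ('f, 'r, 'a) struct. is_model L M T \<and> quasiminimal L M"
proof -
  interpret regular_type L \<CC> \<kappa> p
    by unfold_locales (use assms in \<open>simp_all add: monster_model_def is_model_def\<close>)
  \<comment> \<open>The quasiminimal structure is an elementary substructure of the monster model
    and therefore satisfies \<open>T\<close>.\<close>
  obtain N where "tarski_vaught N" "quasiminimal L (\<CC>\<lparr>dom := N\<rparr>)"
    using quasiminimal_substructure by blast
  moreover have "T \<subseteq> sentences L" "is_model L \<CC> T"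
    using assms(2,3) by (simp_all add: complete_theory_def monster_model_def)
  ultimately show ?thesis using tarski_vaught_is_model by blast
qed

end
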